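(* Let $G$ be a finite group, let $H$ be a subgroup of $G$, and let $p$ be a prime. If the restriction map $$\mathbb{Z}[\mathrm{IBr}(G)] \rightarrow \mathbb{Z}[\mathrm{IBr}(H)]$$ is an isomorphism, then $K \mapsto K \cap H$ is a bijection between the set of conjugacy classes of $p$-regular elements of $G$ and the set of conjugacy classes of $p$-regular elements of $H$ (in particular, for every conjugacy class $K$ of $p$-regular elements of $G$, the set $K \cap H$ is a single conjugacy class of $H$).
   Context: Fix a prime $p$ and a maximal ideal $M$ of the ring $\mathbf{R}$ of algebraic integers in $\mathbb{C}$ with $p \in M$; Brauer characters of all finite groups are computed with respect to this ideal. That is, $F = \mathbf{R}/M$ is an algebraically closed field of characteristic $p$, and the quotient map $\mathbf{R} \to F$ restricts to an isomorphism from the group of complex roots of unity of order prime to $p$ onto $F^\times$. An element of a finite group is $p$-regular if its order is not divisible by $p$. For a finite group $G$ and a finite-dimensional $F$-representation $\mathcal{X}$ of $G$, the Brauer character afforded by $\mathcal{X}$ is the complex-valued function on the set of $p$-regular elements of $G$ sending $g$ to the sum of the unique lifts, to complex roots of unity of order prime to $p$, of the eigenvalues of $\mathcal{X}(g)$ (counted with multiplicity). $\mathrm{IBr}(G)$ denotes the set of Brauer characters afforded by the irreducible $F$-representations of $G$. $\mathbb{Z}[\mathrm{IBr}(G)]$ denotes the ring of generalized Brauer characters of $G$, i.e. the set of $\mathbb{Z}$-linear combinations of elements of $\mathrm{IBr}(G)$, viewed as functions on the $p$-regular elements of $G$; it is a free abelian group with basis $\mathrm{IBr}(G)$. For a subgroup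 $H \le G$, the restriction map sends a generalized Brauer character of $G$ to its restriction to the $p$-regular elements of $H$, which is a generalized Brauer character of $H$. *)

theory Defs
  imports
    "HOL-Algebra.QuotRing"
    "HOL-Algebra.Group_Action"
    "HOL-Algebra.Multiplicative_Group"
    "Jordan_Normal_Form.Char_Poly"
    "Jordan_Normal_Form.VS_Connect"
begin

abbreviation algebraic_integers :: "complex ring" where
  "algebraic_integers \<equiv> class_ring\<lparr>carrier := {z. algebraic_int z}\<rparr>"

text \<open>
  The residue field \<open>algebraic_integers Quot M\<close> has a carrier that depends on \<open>M\<close>, while the
  library's matrices and characteristic polynomials live over a type of class \<open>field\<close>.  The residue
  field is therefore identified with a type \<open>'f\<close> through a ring isomorphism
  \<open>\<iota> \<in> ring_iso (algebraic_integers Quot M) class_ring\<close>; \<open>M\<close> and \<open>\<iota>\<close> are parameters below.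
\<close>

definition reduction :: "complex set \<Rightarrow> (complex set \<Rightarrow> 'f::field) \<Rightarrow> complex \<Rightarrow> 'f" where
  "reduction M \<iota> z = \<iota> (M +>\<^bsub>algebraic_integers\<^esub> z)"

definition p'_roots_of_unity :: "nat \<Rightarrow> complex set" where
  "p'_roots_of_unity p = {z. \<exists>k>0. coprime k p \<and> z ^ k = 1}"

text \<open>
  The unique lift of a nonzero element of the residue field; reduction is injective on
  \<open>p'_roots_of_unity p\<close> and maps it onto the nonzero elements when \<open>p \<in> M\<close>.
\<close>

definition root_lift :: "nat \<Rightarrow> complex set \<Rightarrow> (complex set \<Rightarrow> 'f::field) \<Rightarrow> 'f \<Rightarrow> complex" where
  "root_lift p M \<iota> a = (THE z. z \<in> p'_roots_of_unity p \<and> reduction M \<iota> z = a)"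

definition p_regular :: "nat \<Rightarrow> ('a, 'b) monoid_scheme \<Rightarrow> 'a set" where
  "p_regular p G = {g \<in> carrier G. \<not> p dvd group.ord G g}"

definition p_regular_classes :: "nat \<Rightarrow> ('a, 'b) monoid_scheme \<Rightarrow> 'a set set" where
  "p_regular_classes p G =
     orbits G (p_regular p G) (\<lambda>g. \<lambda>h\<in>carrier G. g \<otimes>\<^bsub>G\<^esub> h \<otimes>\<^bsub>G\<^esub> inv\<^bsub>G\<^esub> g)"

definition representation ::
    "('a, 'b) monoid_scheme \<Rightarrow> nat \<Rightarrow> ('a \<Rightarrow> 'f::field mat) \<Rightarrow> bool" where
  "representation G n X \<longleftrightarrow> X \<in> hom G (units_of (ring_mat TYPE('f) n ()))"

definition irreducible_representation ::
    "('a, 'b) monoid_scheme \<Rightarrow> nat \<Rightarrow> ('a \<Rightarrow> 'f::field mat) \<Rightarrow> bool" where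
  "irreducible_representation G n X \<longleftrightarrow>
     representation G n X \<and> n > 0 \<and>
     (\<forall>W. subspace class_ring W (module_vec TYPE('f) n) \<and>
          (\<forall>g\<in>carrier G. \<forall>w\<in>W. X g *\<^sub>v w \<in> W) \<longrightarrow>
          W = {0\<^sub>v n} \<or> W = carrier_vec n)"

text \<open>
  Functions on the \<open>p\<close>-regular elements are represented by functions that are \<open>undefined\<close>
  elsewhere, so that equality of functions is equality on the \<open>p\<close>-regular elements.
\<close>

definition brauer_character ::
    "nat \<Rightarrow> complex set \<Rightarrow> (complex set \<Rightarrow> 'f::field) \<Rightarrow> ('a, 'b) monoid_scheme \<Rightarrow>
     ('a \<Rightarrow> 'f mat) \<Rightarrow> 'a \<Rightarrow> complex" where
  "brauer_character p M \<iota> G X =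
     (\<lambda>g\<in>p_regular p G. \<Sum>a\<in>#proots (char_poly (X g)). root_lift p M \<iota> a)"

definition IBr ::
    "nat \<Rightarrow> complex set \<Rightarrow> (complex set \<Rightarrow> 'f::field) \<Rightarrow> ('a, 'b) monoid_scheme \<Rightarrow>
     ('a \<Rightarrow> complex) set" where
  "IBr p M \<iota> G = {brauer_character p M \<iota> G X | n X. irreducible_representation G n X}"

definition generalized_brauer_characters ::
    "nat \<Rightarrow> complex set \<Rightarrow> (complex set \<Rightarrow> 'f::field) \<Rightarrow> ('a, 'b) monoid_scheme \<Rightarrow>
     ('a \<Rightarrow> complex) ring" where
  "generalized_brauer_characters p M \<iota> G =
     \<lparr>carrier = {(\<lambda>g\<in>p_regular p G. \<Sum>\<phi>\<in>S. of_int (c \<phi>) * \<phi> g) | S (c :: _ \<Rightarrow> int).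
                   finite S \<and> S \<subseteq> IBr p M \<iota> G},
      monoid.mult = (\<lambda>\<phi> \<psi>. \<lambda>g\<in>p_regular p G. \<phi> g * \<psi> g),
      one = (\<lambda>g\<in>p_regular p G. 1),
      zero = (\<lambda>g\<in>p_regular p G. 0),
      add = (\<lambda>\<phi> \<psi>. \<lambda>g\<in>p_regular p G. \<phi> g + \<psi> g)\<rparr>"

end

theory Submission
  imports Defs "Jordan_Normal_Form.Schur_Decomposition" "HOL-Number_Theory.Cong"
begin

text \<open>
  Let \<open>x\<close> be a \<open>p\<close>-regular element of order \<open>n\<close> and \<open>\<zeta>\<close> a primitive \<open>n\<close>-th root of unity.  Inducing the
  linear characters of \<open>\<langle>x\<rangle>\<close> gives monomial representations in characteristic \<open>p\<close> that lift to
  characteristic 0, so their Brauer characters are traces of complex monomial matrices.  With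
  integer coefficients \<open>c\<^sub>j\<close> they combine to \<open>y \<mapsto> \<Sum>\<^sub>t q (\<zeta>\<^sup>e)\<close>, where \<open>q = \<Sum>\<^sub>j c\<^sub>j X\<^sup>j\<close> and \<open>t\<close> ranges over the
  representatives of the cosets of \<open>\<langle>x\<rangle>\<close> with \<open>y t = t x\<^sup>e\<close>.

  A polynomial \<open>q\<close> with complex coefficients vanishing at all \<open>\<zeta>\<^sup>e \<noteq> \<zeta>\<close> shows that generalized Brauer
  characters separate classes.  If two elements of \<open>H\<close> are fused in \<open>G\<close>, then surjectivity of the
  restriction map makes all generalized Brauer characters of \<open>H\<close> agree on them, so they are already
  conjugate in \<open>H\<close>.

  An integer polynomial \<open>q\<close> that is nonnegative at all \<open>\<zeta>\<^sup>e\<close> and nonzero exactly at the primitive ones gives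
  a generalized Brauer character of \<open>G\<close> with nonzero value at \<open>x\<close>, supported on the conjugates of the
  generators of \<open>\<langle>x\<rangle>\<close>.  If no conjugate of \<open>x\<close> lay in \<open>H\<close>, its restriction to \<open>H\<close> would be zero,
  contradicting injectivity.
\<close>

subsection \<open>Reduction modulo the maximal ideal\<close>

lemma algebraic_int_root_of_unity:
  fixes z :: "'a :: field_char_0"
  assumes "z ^ k = 1" "k > 0"
  shows "algebraic_int z"
proof -
  let ?q = "monom 1 k - 1 :: 'a poly"
  have d: "degree ?q = k"
  proof -
    have "degree ?q = degree (monom 1 k + - 1 :: 'a poly)" by simp
    also have "\<dots> = k"
      using assms(2) by (subst degree_add_eq_left) (auto simp: degree_monom_eq)
    finally show ?thesis .
  qed
  show ?thesis
  proof (rule algebraic_int.intros[of ?q])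
    show "lead_coeff ?q = 1" unfolding d using assms(2) by simp
    show "poly ?q z = 0" using assms(1) by (simp add: poly_monom)
    show "\<forall>i. coeff ?q i \<in> \<int>" by (auto simp: coeff_1)
  qed
qed

locale modular_reduction =
  fixes p :: nat and M :: "complex set" and \<iota> :: "complex set \<Rightarrow> 'f::field"
  assumes prime: "prime p"
    and maximal: "maximalideal M algebraic_integers"
    and p_in: "of_nat p \<in> M"
    and iso: "\<iota> \<in> ring_iso (algebraic_integers Quot M) class_ring"
begin

abbreviation red :: "complex \<Rightarrow> 'f" where "red \<equiv> reduction M \<iota>"

interpretation M: maximalideal M algebraic_integers by (rule maximal)

lemma red_hom: "red \<in> Ring.ring_hom algebraic_integers class_ring"
  using ring_hom_trans[OF M.rcos_ring_hom, of \<iota> class_ring] iso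
  by (auto simp: ring_iso_def o_def reduction_def[abs_def])

text \<open>Closure of the algebraic integers under ring operations is read off from the ring axioms
  contained in \<open>maximalideal M algebraic_integers\<close>.\<close>

lemma algebraic_int_mult: "algebraic_int x \<Longrightarrow> algebraic_int y \<Longrightarrow> algebraic_int (x * y :: complex)"
  using M.m_closed[of x y] by (simp add: class_ring_simps)

lemma algebraic_int_add: "algebraic_int x \<Longrightarrow> algebraic_int y \<Longrightarrow> algebraic_int (x + y :: complex)"
  using M.a_closed[of x y] by (simp add: class_ring_simps)

lemma red_mult: "algebraic_int x \<Longrightarrow> algebraic_int y \<Longrightarrow> red (x * y) = red x * red y"
  using ring_hom_mult[OF red_hom, of x y] by (simp add: class_ring_simps)

lemma red_add: "algebraic_int x \<Longrightarrow> algebraic_int y \<Longrightarrow> red (x + y) = red x + red y"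
  using ring_hom_add[OF red_hom, of x y] by (simp add: class_ring_simps)

lemma red_1 [simp]: "red 1 = 1"
  using ring_hom_one[OF red_hom] by (simp add: class_ring_simps)

lemma red_0 [simp]: "red 0 = 0"
  using red_add[of 0 0] by (metis add_0 add_cancel_left_right algebraic_int_0)

lemma red_minus: "algebraic_int x \<Longrightarrow> red (- x) = - red x"
  using red_add[of x "- x"] by (simp add: eq_neg_iff_add_eq_0 add.commute)

lemma algebraic_int_diff: "algebraic_int x \<Longrightarrow> algebraic_int y \<Longrightarrow> algebraic_int (x - y :: complex)"
  using algebraic_int_add[of x "- y"] by simp

lemma red_diff: "algebraic_int x \<Longrightarrow> algebraic_int y \<Longrightarrow> red (x - y) = red x - red y"
  using red_add[of x "- y"] red_minus[of y] by simp

lemma red_of_nat [simp]: "red (of_nat k) = of_nat k"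
  by (induction k) (auto simp: red_add)

lemma red_of_int [simp]: "red (of_int k) = of_int k"
  by (cases k rule: int_cases2) (auto simp: red_minus)

lemma red_power: "algebraic_int x \<Longrightarrow> algebraic_int (x ^ k) \<and> red (x ^ k) = red x ^ k"
  by (induction k) (auto simp: red_mult algebraic_int_mult)

lemma red_sum:
  assumes "finite I" "\<And>i. i \<in> I \<Longrightarrow> algebraic_int (f i)"
  shows "algebraic_int (sum f I) \<and> red (sum f I) = (\<Sum>i\<in>I. red (f i))"
  using assms by (induction I rule: finite_induct) (auto simp: red_add algebraic_int_add)

lemma of_nat_p_eq_0: "(of_nat p :: 'f) = 0"
proof -
  have "M +>\<^bsub>algebraic_integers\<^esub> of_nat p = M +>\<^bsub>algebraic_integers\<^esub> 0"
    using M.a_rcos_const[OF p_in] M.a_rcos_const[OF additive_subgroup.zero_closed[OF M.is_additive_subgroup]] by (simp add: class_ring_simps)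
  then have "red (of_nat p) = red 0"
    by (simp add: reduction_def)
  then show ?thesis by simp
qed

text \<open>By Bezout, \<open>a * k + b * p = 1\<close> for some integers \<open>a\<close> and
  \<open>b\<close>; if both \<open>k\<close> and \<open>p\<close> became 0 in the residue field,
  this would read 0 = 1.\<close>

lemma of_nat_coprime_p: 
  assumes "coprime k p" shows "(of_nat k :: 'f) \<noteq> 0"
proof
  assume k: "(of_nat k :: 'f) = 0"
  from assms have "coprime (int k) (int p)" by simp
  then obtain a b where "a * int k + b * int p = 1"
    using bezout_int[of "int k" "int p"] by (metis coprime_imp_gcd_eq_1)
  then have "(of_int (a * int k + b * int p) :: 'f) = 1" by simp
  then show False by (simp add: k of_nat_p_eq_0)
qed

text \<open>If \<open>u = z / w\<close> is an \<open>n\<close>-th root of unity other than 1, then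
  the geometric sum of its powers vanishes. When \<open>u\<close> reduces to 1, that sum reduces to
  \<open>n\<close>, which is nonzero in the residue field because \<open>n\<close> is prime to
  \<open>p\<close>.\<close>

lemma red_inj_on_roots_of_unity: "inj_on red (p'_roots_of_unity p)"
proof (rule inj_onI)
  fix z w
  assume zw: "z \<in> p'_roots_of_unity p" "w \<in> p'_roots_of_unity p" and eq: "red z = red w"
  from zw obtain k l where k: "k > 0" "coprime k p" "z ^ k = 1" and l: "l > 0" "coprime l p" "w ^ l = 1"
    by (auto simp: p'_roots_of_unity_def)
  have w0: "w \<noteq> 0" using l by (auto simp: power_0_left)
  define n u where "n = k * l" and "u = z / w"
  have n: "n > 0" "coprime n p" using k l by (auto simp: n_def)
  have un: "u ^ n = 1"
    unfolding u_def n_def power_divide power_mult using k l by (metis power_mult mult.commute power_one div_by_1)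
  have ai: "algebraic_int u" "algebraic_int w"
    using algebraic_int_root_of_unity un n l by blast+
  have "red z = red u * red w"
    using red_mult[OF ai] w0 by (simp add: u_def)
  moreover have "red w \<noteq> 0"
    using red_power[OF ai(2), of l] l by (auto simp: power_0_left)
  ultimately have ru: "red u = 1" using eq by simp
  show "z = w"
  proof (rule ccontr)
    assume "z \<noteq> w"
    then have "u \<noteq> 1" using w0 by (auto simp: u_def)
    then have "(\<Sum>i<n. u ^ i) = 0"
      using un by (simp add: geometric_sum)
    then have "(\<Sum>i<n. red (u ^ i)) = 0"
      using red_sum[of "{..<n}" "\<lambda>i. u ^ i"] red_power[OF ai(1)] by simp
    then show False
      using red_power[OF ai(1)] ru of_nat_coprime_p[OF n(2)] by simp
  qed
qed

lemma root_lift_red: "z \<in> p'_roots_of_unity p \<Longrightarrow> root_lift p M \<iota> (red z) = z"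
  unfolding root_lift_def using red_inj_on_roots_of_unity
  by (intro the_equality) (auto dest: inj_onD)

end

subsection \<open>Brauer characters of reducible representations\<close>

text \<open>The columns of \<open>P\<close> are a basis of \<open>W\<close> extended to a basis of
  the whole space. Conjugation by \<open>P\<close> then makes every matrix that preserves
  \<open>W\<close> block upper triangular.\<close>

lemma (in vec_space) subspace_adapted_basis:
  assumes W: "subspace class_ring W V" and W0: "W \<noteq> {0\<^sub>v n}" and W1: "W \<noteq> carrier_vec n"
  obtains k P Q where "0 < k" "k < n" "P \<in> carrier_mat n n" "Q \<in> carrier_mat n n"
    "P * Q = 1\<^sub>m n" "Q * P = 1\<^sub>m n"
    "W = {P *\<^sub>v (c @\<^sub>v 0\<^sub>v (n - k)) | c. c \<in> carrier_vec k}"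
proof -
  have sub: "submodule class_ring W V" using W by (simp add: subspace_def)
  have WV: "W \<subseteq> carrier_vec n" using submodule.subset[OF sub] by simp
  have small: "finite S \<and> card S \<le> n" if "S \<subseteq> carrier_vec n" "lin_indpt S" for S
    using li_le_dim[OF fin_dim, of S] that by (auto simp: dim_is_n)
  \<comment> \<open>A maximal independent subset of \<open>W\<close> is a basis of \<open>W\<close>;
    one exists because \<open>small\<close> bounds the size of independent sets by the
    dimension.\<close>
  have "\<exists>B. finite B \<and> maximal B (\<lambda>S. S \<subseteq> W \<and> lin_indpt S)"
  proof (rule maximal_exists[where B = "{}" and N = n])
    show "finite S \<and> card S \<le> n" if "S \<subseteq> W \<and> lin_indpt S" for S
      using small[of S] that WV by blast
    show "{} \<subseteq> W \<and> lin_indpt {}" by (auto simp: lin_dep_def)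
  qed
  then obtain B where "finite B" and mB: "maximal B (\<lambda>S. S \<subseteq> W \<and> lin_indpt S)"
    by (elim exE conjE)
  then have B: "finite B" "B \<subseteq> W" "lin_indpt B"
    by (simp_all add: maximal_def)
  have maxB: "S = B" if "B \<subseteq> S" "S \<subseteq> W" "lin_indpt S" for S
    using mB that by (simp add: maximal_def)
  have spanB: "span B = W"
  proof
    show "span B \<subseteq> W" by (rule span_is_subset[OF B(2) sub])
    show "W \<subseteq> span B"
    proof (rule ccontr)
      assume "\<not> W \<subseteq> span B"
      then obtain w where w: "w \<in> W" "w \<notin> span B" by auto
      have wB: "w \<notin> B" using w(2) B WV in_own_span[of B] by auto
      have "lin_indpt (B \<union> {w})"
        using lin_dep_iff_in_span[of B w] B WV w wB by auto
      then show False using maxB[of "B \<union> {w}"] w wB B(2) by auto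
    qed
  qed
  have "\<exists>C. finite C \<and> maximal C (\<lambda>S. B \<subseteq> S \<and> S \<subseteq> carrier_vec n \<and> lin_indpt S)"
  proof (rule maximal_exists[where B = B and N = n])
    show "finite S \<and> card S \<le> n" if "B \<subseteq> S \<and> S \<subseteq> carrier_vec n \<and> lin_indpt S" for S
      using small[of S] that by blast
    show "B \<subseteq> B \<and> B \<subseteq> carrier_vec n \<and> lin_indpt B" using B WV by blast
  qed
  then obtain C where "finite C"
      and mC: "maximal C (\<lambda>S. B \<subseteq> S \<and> S \<subseteq> carrier_vec n \<and> lin_indpt S)"
    by (elim exE conjE)
  then have C: "finite C" "B \<subseteq> C" "C \<subseteq> carrier_vec n" "lin_indpt C"
    by (simp_all add: maximal_def)
  have maxC: "S = C" if "C \<subseteq> S" "S \<subseteq> carrier_vec n" "lin_indpt S" for S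
    using mC that C(2) by (simp add: maximal_def)
  have "maximal C (\<lambda>S. S \<subseteq> carrier_vec n \<and> lin_indpt S)"
    unfolding maximal_def using C maxC by blast
  then have basisC: "basis C" using max_li_is_basis[of C] by simp
  then have spanC: "span C = carrier_vec n" and cardC: "card C = n"
    using dim_basis[OF C(1)] by (auto simp: basis_def dim_is_n)
  obtain bs where bs: "set bs = B" "distinct bs" using finite_distinct_list[OF B(1)] by auto
  obtain cs where cs: "set cs = C - B" "distinct cs"
    using finite_distinct_list[of "C - B"] C(1) by auto
  define k where "k = length bs"
  have "card B \<le> card C" by (rule card_mono[OF C(1,2)])
  then have k: "k = card B" "k \<le> n" "length cs = n - k"
    using bs cs C B cardC by (auto simp: k_def card_Diff_subset simp flip: distinct_card)
  have k0: "0 < k"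
  proof (rule ccontr)
    assume "\<not> 0 < k"
    then have "B = {}" using k B by auto
    then show False using spanB W0 by (auto simp: span_empty)
  qed
  have kn: "k < n"
  proof (rule ccontr)
    assume "\<not> k < n"
    then have "B = C" using k C cardC by (metis card_subset_eq le_antisym not_less)
    then show False using spanB spanC W1 by auto
  qed
  \<comment> \<open>The basis of \<open>W\<close> comes first, so that \<open>W\<close> corresponds
    to the coordinate vectors ending in \<open>n - k\<close> zeros.\<close>
  define ds where "ds = bs @ cs"
  have ds: "set ds = C" "distinct ds" "length ds = n"
    using bs cs C k by (auto simp: ds_def k_def)
  define P where "P = mat_of_cols n ds"
  have P: "P \<in> carrier_mat n n"
    using mat_of_cols_carrier(1)[of n ds] ds(3) by (simp add: P_def)
  have P_mult: "P *\<^sub>v vec n (\<lambda>i. a (ds ! i)) = lincomb a C" for a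
  proof -
    have "lincomb a C = lincomb_list (\<lambda>i. a (ds ! i)) ds"
      using lincomb_as_lincomb_list_distinct[of ds a] ds(1,2) C(3) by simp
    also have "\<dots> = mat_of_cols n ds *\<^sub>v vec (length ds) (\<lambda>i. a (ds ! i))"
      by (rule lincomb_list_as_mat_mult) (use ds(1) C(3) in auto)
    finally show ?thesis by (simp only: P_def ds(3))
  qed
  have "\<exists>v \<in> carrier_vec n. P *\<^sub>v v = u" if "u \<in> carrier_vec n" for u
    using finite_in_span[of C u] C spanC that P_mult by (metis vec_carrier cV)
  then have "\<forall>j. \<exists>v. j < n \<longrightarrow> v \<in> carrier_vec n \<and> P *\<^sub>v v = unit_vec n j"
    by (meson unit_vec_carrier)
  then obtain v where v: "\<And>j. j < n \<Longrightarrow> v j \<in> carrier_vec n \<and> P *\<^sub>v v j = unit_vec n j"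
    by metis
  \<comment> \<open>Column \<open>j\<close> solves \<open>P *\<^sub>v v j = unit_vec n j\<close>, so
    \<open>Q\<close> is a right inverse of the square matrix \<open>P\<close> and therefore a
    two-sided one.\<close>
  define Q where "Q = mat_of_cols n (map v [0..<n])"
  have Q: "Q \<in> carrier_mat n n"
    using mat_of_cols_carrier(1)[of n "map v [0..<n]"] by (simp add: Q_def del: mat_of_cols_carrier)
  have PQ: "P * Q = 1\<^sub>m n"
  proof (rule mat_col_eqI)
    fix j assume j: "j < dim_col (1\<^sub>m n :: 'a mat)"
    then have "col Q j = v j" using v by (simp add: Q_def)
    then show "col (P * Q) j = col (1\<^sub>m n) j"
      using col_mult2[OF P Q, of j] v j by simp
  qed (use P Q in auto)
  have QP: "Q * P = 1\<^sub>m n" using mat_mult_left_right_inverse[OF P Q PQ] .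
  have lincomb_C: "lincomb b C = lincomb b B" if b: "\<And>x. x \<in> C - B \<Longrightarrow> b x = 0" for b
  proof -
    have B': "B \<subseteq> carrier_vec n" using C by blast
    have "lincomb b C = lincomb b (C - B) + lincomb b B"
      using lincomb_vec_diff_add[OF C(3,2) C(1)] by simp
    also have "lincomb b (C - B) = 0\<^sub>v n"
      by (rule lincomb_zero) (use C b in auto)
    also have "0\<^sub>v n + lincomb b B = lincomb b B"
      using lincomb_closed[of B b] B' by simp
    finally show ?thesis .
  qed
  have "W = {P *\<^sub>v (c @\<^sub>v 0\<^sub>v (n - k)) | c. c \<in> carrier_vec k}"
  proof (intro equalityI subsetI)
    fix w assume "w \<in> W"
    then obtain a where a: "lincomb a B = w"
      using finite_in_span[of B w] B WV spanB by auto
    define b where "b x = (if x \<in> B then a x else 0)" for x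
    have "lincomb b C = lincomb b B" by (rule lincomb_C) (simp add: b_def)
    also have "\<dots> = lincomb a B"
      by (rule lincomb_cong) (use B WV in \<open>auto simp: b_def\<close>)
    finally have "P *\<^sub>v vec n (\<lambda>i. b (ds ! i)) = w" using P_mult a by simp
    moreover have "b (cs ! j) = 0" if "j < n - k" for j
      using that k(3) cs(1) nth_mem[of j cs] by (auto simp: b_def)
    then have "vec n (\<lambda>i. b (ds ! i)) = vec k (\<lambda>i. b (ds ! i)) @\<^sub>v 0\<^sub>v (n - k)"
      using kn by (intro eq_vecI) (auto simp: ds_def nth_append k_def)
    ultimately show "w \<in> {P *\<^sub>v (c @\<^sub>v 0\<^sub>v (n - k)) | c. c \<in> carrier_vec k}"
      by (intro CollectI exI[of _ "vec k (\<lambda>i. b (ds ! i))"]) auto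
  next
    fix w assume "w \<in> {P *\<^sub>v (c @\<^sub>v 0\<^sub>v (n - k)) | c. c \<in> carrier_vec k}"
    then obtain c where c: "c \<in> carrier_vec k" "w = P *\<^sub>v (c @\<^sub>v 0\<^sub>v (n - k))" by auto
    \<comment> \<open>Coordinates are indexed by position and \<open>lincomb\<close> by vectors; the
      \<open>THE\<close> term is the position of \<open>x\<close> in the distinct list
      \<open>bs\<close>.\<close>
    define b where "b x = (if x \<in> B then c $ (THE i. i < k \<and> bs ! i = x) else 0)" for x
    have "b (bs ! i) = c $ i" if "i < k" for i
    proof -
      have "(THE l. l < k \<and> bs ! l = bs ! i) = i"
        using that bs(2) by (intro the_equality) (auto simp: k_def nth_eq_iff_index_eq)
      then show ?thesis using that bs by (auto simp: b_def k_def)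
    qed
    moreover have "b (cs ! j) = 0" if "j < n - k" for j
      using that k(3) cs(1) nth_mem[of j cs] by (auto simp: b_def)
    ultimately have "vec n (\<lambda>i. b (ds ! i)) = c @\<^sub>v 0\<^sub>v (n - k)"
      using kn c(1) by (intro eq_vecI) (auto simp: ds_def nth_append k_def)
    then have "w = lincomb b C" using c(2) P_mult[of b] by simp
    also have "\<dots> = lincomb b B" by (rule lincomb_C) (simp add: b_def)
    also have "\<dots> \<in> span B" using B(1) by (auto simp: span_def)
    finally show "w \<in> W" using spanB by simp
  qed
  then show thesis by (rule that[OF k0 kn P Q PQ QP])
qed

text \<open>The characteristic matrix of a block upper triangular matrix is again block upper
  triangular, now over polynomials, so its determinant is the product of those of the diagonal
  blocks.\<close>

lemma char_poly_four_block_lower_left_zero: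
  fixes A1 :: "'a :: idom mat"
  assumes A1: "A1 \<in> carrier_mat k k" and A2: "A2 \<in> carrier_mat k m" and A4: "A4 \<in> carrier_mat m m"
  shows "char_poly (four_block_mat A1 A2 (0\<^sub>m m k) A4) = char_poly A1 * char_poly A4"
proof -
  let ?c = "\<lambda>A. [:0, 1:] \<cdot>\<^sub>m 1\<^sub>m (dim_row A) + map_mat (\<lambda>a. [:- a:]) A"
  let ?A = "four_block_mat A1 A2 (0\<^sub>m m k) A4"
  have "?c ?A = four_block_mat (?c A1) (map_mat (\<lambda>a. [:- a:]) A2) (0\<^sub>m m k) (?c A4)"
    by (rule eq_matI) (use A1 A2 A4 in \<open>auto simp: one_poly_def\<close>)
  moreover have "det \<dots> = det (?c A1) * det (?c A4)"
    by (rule det_four_block_mat_lower_left_zero[of _ k _ m]) (use A1 A2 A4 in auto)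
  ultimately show ?thesis by (simp add: char_poly_defs)
qed

lemma (in group) representation_iff:
  fixes X :: "'a \<Rightarrow> 'f::field mat"
  shows "representation G n X \<longleftrightarrow>
     (\<forall>g\<in>carrier G. X g \<in> carrier_mat n n) \<and> X \<one> = 1\<^sub>m n \<and>
     (\<forall>g\<in>carrier G. \<forall>h\<in>carrier G. X (g \<otimes> h) = X g * X h)" (is "_ \<longleftrightarrow> ?R")
proof
  interpret R: ring "ring_mat TYPE('f) n ()" by (rule ring_mat)
  interpret U: group "units_of (ring_mat TYPE('f) n ())" by (rule R.units_group)
  assume "representation G n X"
  then have X: "X \<in> hom G (units_of (ring_mat TYPE('f) n ()))" by (simp add: representation_def)
  have "X g \<in> Units (ring_mat TYPE('f) n ())" if "g \<in> carrier G" for g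
    using hom_in_carrier[OF X that] by (simp add: units_of_carrier)
  moreover have "X (g \<otimes> h) = X g * X h" if "g \<in> carrier G" "h \<in> carrier G" for g h
    using hom_mult[OF X that] by (simp add: units_of_mult ring_mat_simps)
  moreover have "X \<one> = 1\<^sub>m n"
    using hom_one[OF X is_group U.is_group] by (simp add: units_of_one ring_mat_simps)
  ultimately show ?R by (auto simp: Units_def ring_mat_simps)
next
  assume R: ?R
  have "X g \<in> Units (ring_mat TYPE('f) n ())" if g: "g \<in> carrier G" for g
  proof -
    have "X g * X (inv g) = 1\<^sub>m n" "X (inv g) * X g = 1\<^sub>m n"
      using R g by (metis inv_closed r_inv, metis inv_closed l_inv)
    then show ?thesis using R g by (auto simp: Units_def ring_mat_simps intro!: bexI[of _ "X (inv g)"])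
  qed
  then show "representation G n X"
    using R by (auto simp: representation_def hom_def units_of_def ring_mat_simps)
qed

text \<open>In a basis adapted to a proper nonzero invariant subspace all matrices become block
  upper triangular. The diagonal blocks \<open>Y\<close> and \<open>Z\<close> are the
  representations on the subspace and on the quotient.\<close>

lemma (in group) reducible_representation:
  fixes X :: "'a \<Rightarrow> 'f::field mat"
  assumes rep: "representation G n X" and n: "n > 0" and red: "\<not> irreducible_representation G n X"
  obtains k Y Z where "0 < k" "k < n" "representation G k Y" "representation G (n - k) Z"
    "\<And>g. g \<in> carrier G \<Longrightarrow> char_poly (X g) = char_poly (Y g) * char_poly (Z g)"
proof -
  have X: "X g \<in> carrier_mat n n" if "g \<in> carrier G" for g using rep that by (simp add: representation_iff)
  have X1: "X \<one> = 1\<^sub>m n" using rep by (simp add: representation_iff)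
  have Xm: "X (g \<otimes> h) = X g * X h" if "g \<in> carrier G" "h \<in> carrier G" for g h
    using rep that by (simp add: representation_iff)
  obtain W where W: "subspace class_ring W (module_vec TYPE('f) n)"
      and inv: "\<And>g w. g \<in> carrier G \<Longrightarrow> w \<in> W \<Longrightarrow> X g *\<^sub>v w \<in> W"
      and W': "W \<noteq> {0\<^sub>v n}" "W \<noteq> carrier_vec n"
    using red rep n by (auto simp: irreducible_representation_def)
  obtain k P Q where k: "0 < k" "k < n" and P: "P \<in> carrier_mat n n" and Q: "Q \<in> carrier_mat n n"
      and PQ: "P * Q = 1\<^sub>m n" and QP: "Q * P = 1\<^sub>m n"
      and W_eq: "W = {P *\<^sub>v (c @\<^sub>v 0\<^sub>v (n - k)) | c. c \<in> carrier_vec k}"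
    by (rule vec_space.subspace_adapted_basis[OF W W'])
  define B where "B g = Q * X g * P" for g
  have B: "B g \<in> carrier_mat n n" if "g \<in> carrier G" for g using P Q X[OF that] by (simp add: B_def)
  have B1: "B \<one> = 1\<^sub>m n" using P Q QP by (simp add: B_def X1)
  have Bm: "B (g \<otimes> h) = B g * B h" if g: "g \<in> carrier G" and h: "h \<in> carrier G" for g h
  proof -
    have "B g * B h = Q * X g * (P * Q) * (X h * P)"
      using P Q X[OF g] X[OF h] by (simp add: B_def assoc_mult_mat[of _ n n _ n _ n])
    also have "\<dots> = B (g \<otimes> h)"
      using P Q X[OF g] X[OF h] by (simp add: B_def PQ Xm g h assoc_mult_mat[of _ n n _ n _ n])
    finally show ?thesis by simp
  qed
  \<comment> \<open>Column \<open>j < k\<close> of \<open>B g\<close> holds the coordinates of the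
    image of the \<open>j\<close>-th basis vector of \<open>W\<close>; this image lies in
    \<open>W\<close>, so the last \<open>n - k\<close> coordinates vanish.\<close>
  have B0: "B g $$ (i, j) = 0" if g: "g \<in> carrier G" and ij: "k \<le> i" "i < n" "j < k" for g i j
  proof -
    let ?e = "unit_vec n j :: 'f vec"
    have "?e = unit_vec k j @\<^sub>v 0\<^sub>v (n - k)"
      using k ij by (intro eq_vecI) (auto simp: unit_vec_def)
    then have "P *\<^sub>v ?e \<in> W" unfolding W_eq using ij by (auto intro!: exI[of _ "unit_vec k j"])
    then have "X g *\<^sub>v (P *\<^sub>v ?e) \<in> W" by (rule inv[OF g])
    then obtain c where c: "c \<in> carrier_vec k" "X g *\<^sub>v (P *\<^sub>v ?e) = P *\<^sub>v (c @\<^sub>v 0\<^sub>v (n - k))"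
      unfolding W_eq by auto
    have c': "c @\<^sub>v 0\<^sub>v (n - k) \<in> carrier_vec n"
      using c k append_carrier_vec[OF c(1), of "0\<^sub>v (n - k)" "n - k"] by simp
    have "B g *\<^sub>v ?e = Q *\<^sub>v (X g *\<^sub>v (P *\<^sub>v ?e))"
      using P Q X[OF g] by (simp add: B_def assoc_mult_mat_vec[of _ n n _ n])
    also have "\<dots> = c @\<^sub>v 0\<^sub>v (n - k)"
      unfolding c(2) using P Q QP c' by (simp flip: assoc_mult_mat_vec[of _ n n _ n])
    finally have "(B g *\<^sub>v ?e) $ i = 0" using c ij by simp
    then show ?thesis using B[OF g] ij k by (simp add: scalar_prod_right_unit[of _ n])
  qed
  define Y where "Y g = mat k k (\<lambda>(i, j). B g $$ (i, j))" for g
  define U where "U g = mat k (n - k) (\<lambda>(i, j). B g $$ (i, j + k))" for g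
  define Z where "Z g = mat (n - k) (n - k) (\<lambda>(i, j). B g $$ (i + k, j + k))" for g
  have c: "Y g \<in> carrier_mat k k" "U g \<in> carrier_mat k (n - k)" "Z g \<in> carrier_mat (n - k) (n - k)" for g
    by (auto simp: Y_def U_def Z_def)
  have B_block: "B g = four_block_mat (Y g) (U g) (0\<^sub>m (n - k) k) (Z g)" if g: "g \<in> carrier G" for g
    using B[OF g] k B0[OF g] by (intro eq_matI) (auto simp: Y_def U_def Z_def)
  \<comment> \<open>Comparing diagonal blocks turns multiplicativity of \<open>B\<close> into
    multiplicativity of \<open>Y\<close> and of \<open>Z\<close>, whatever the upper right blocks
    are.\<close>
  have block_eq: "Y' = Y'' \<and> Z' = Z''"
    if "four_block_mat Y' U' (0\<^sub>m (n - k) k) Z' = four_block_mat Y'' U'' (0\<^sub>m (n - k) k) Z''"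
      and "Y' \<in> carrier_mat k k" "Y'' \<in> carrier_mat k k" "Z' \<in> carrier_mat (n - k) (n - k)"
        "Z'' \<in> carrier_mat (n - k) (n - k)" "U' \<in> carrier_mat k (n - k)" "U'' \<in> carrier_mat k (n - k)"
    for Y' Y'' U' U'' Z' Z'' :: "'f mat"
  proof
    have e: "four_block_mat Y' U' (0\<^sub>m (n - k) k) Z' $$ ij = four_block_mat Y'' U'' (0\<^sub>m (n - k) k) Z'' $$ ij"
      for ij using that(1) by simp
    show "Y' = Y''"
    proof (rule eq_matI)
      fix i j assume "i < dim_row Y''" "j < dim_col Y''"
      then show "Y' $$ (i, j) = Y'' $$ (i, j)"
        using that(2-) e[of "(i, j)"] by (auto simp: index_mat_four_block)
    qed (use that(2-) in auto)
    show "Z' = Z''"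
    proof (rule eq_matI)
      fix i j assume "i < dim_row Z''" "j < dim_col Z''"
      then show "Z' $$ (i, j) = Z'' $$ (i, j)"
        using that(2-) e[of "(i + k, j + k)"] by (auto simp: index_mat_four_block)
    qed (use that(2-) in auto)
  qed
  have "Y \<one> = 1\<^sub>m k \<and> Z \<one> = 1\<^sub>m (n - k)"
    using k unfolding Y_def Z_def B1 by (auto intro!: eq_matI)
  moreover have "Y (g \<otimes> h) = Y g * Y h \<and> Z (g \<otimes> h) = Z g * Z h"
    if g: "g \<in> carrier G" and h: "h \<in> carrier G" for g h
  proof -
    have "four_block_mat (Y (g \<otimes> h)) (U (g \<otimes> h)) (0\<^sub>m (n - k) k) (Z (g \<otimes> h)) = B g * B h"
      using B_block[of "g \<otimes> h"] Bm[OF g h] g h by simp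
    also have "\<dots> = four_block_mat (Y g * Y h) (Y g * U h + U g * Z h) (0\<^sub>m (n - k) k) (Z g * Z h)"
      unfolding B_block[OF g] B_block[OF h]
      by (subst mult_four_block_mat[OF c(1) c(2) _ c(3) c(1) c(2) _ c(3)]) (use c[of g] c[of h] in auto)
    finally show ?thesis by (rule block_eq) (use c in \<open>auto intro!: mult_carrier_mat add_carrier_mat\<close>)
  qed
  ultimately have "representation G k Y" "representation G (n - k) Z"
    using c by (auto simp: representation_iff)
  moreover have "char_poly (X g) = char_poly (Y g) * char_poly (Z g)" if g: "g \<in> carrier G" for g
  proof -
    have "similar_mat (B g) (X g)"
      using similar_mat_witI[OF QP PQ B_def B[OF g] X[OF g] Q P] by (auto simp: similar_mat_def)
    then have "char_poly (X g) = char_poly (B g)" by (simp add: char_poly_similar)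
    then show ?thesis
      unfolding B_block[OF g] by (simp add: char_poly_four_block_lower_left_zero[OF c])
  qed
  ultimately show thesis by (rule that[OF k])
qed

section \<open>Integer combinations of irreducible Brauer characters\<close>

abbreviation gbc where
  "gbc p M \<iota> G \<equiv> carrier (generalized_brauer_characters p M \<iota> G)"

lemma gbc_eq:
  "gbc p M \<iota> G = {(\<lambda>g\<in>p_regular p G. \<Sum>\<phi>\<in>S. of_int (c \<phi>) * \<phi> g) | S (c :: _ \<Rightarrow> int).
                   finite S \<and> S \<subseteq> IBr p M \<iota> G}"
  by (simp add: generalized_brauer_characters_def)

lemma gbc_zero: "(\<lambda>g\<in>p_regular p G. 0) \<in> gbc p M \<iota> G"
  unfolding gbc_eq by (intro CollectI exI[of _ "{}"]) auto

lemma gbc_IBr: "\<phi> \<in> IBr p M \<iota> G \<Longrightarrow> \<phi> \<in> gbc p M \<iota> G"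
  unfolding gbc_eq
  by (intro CollectI exI[of _ "{\<phi>}"] exI[of _ "\<lambda>_. 1"]) (auto simp: IBr_def brauer_character_def)

lemma gbc_add:
  assumes "\<phi> \<in> gbc p M \<iota> G" "\<psi> \<in> gbc p M \<iota> G"
  shows "(\<lambda>g\<in>p_regular p G. \<phi> g + \<psi> g) \<in> gbc p M \<iota> G"
proof -
  obtain S c where S: "finite S" "S \<subseteq> IBr p M \<iota> G"
      and \<phi>: "\<phi> = (\<lambda>g\<in>p_regular p G. \<Sum>\<chi>\<in>S. of_int (c \<chi>) * \<chi> g)"
    using assms(1) unfolding gbc_eq by auto
  obtain T d where T: "finite T" "T \<subseteq> IBr p M \<iota> G"
      and \<psi>: "\<psi> = (\<lambda>g\<in>p_regular p G. \<Sum>\<chi>\<in>T. of_int (d \<chi>) * \<chi> g)"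
    using assms(2) unfolding gbc_eq by auto
  \<comment> \<open>Both coefficient functions are extended by zero to \<open>S \<union> T\<close>
    before they are added.\<close>
  define e where "e \<chi> = (if \<chi> \<in> S then c \<chi> else 0) + (if \<chi> \<in> T then d \<chi> else 0)" for \<chi>
  have "(\<Sum>\<chi>\<in>S \<union> T. of_int (e \<chi>) * \<chi> g) =
      (\<Sum>\<chi>\<in>S. of_int (c \<chi>) * \<chi> g) + (\<Sum>\<chi>\<in>T. of_int (d \<chi>) * \<chi> g)" for g
  proof -
    have "(\<Sum>\<chi>\<in>S. of_int (c \<chi>) * \<chi> g) = (\<Sum>\<chi>\<in>S \<union> T. if \<chi> \<in> S then of_int (c \<chi>) * \<chi> g else 0)"
      using S T by (intro sum.mono_neutral_cong_left) auto
    moreover have "(\<Sum>\<chi>\<in>T. of_int (d \<chi>) * \<chi> g) = (\<Sum>\<chi>\<in>S \<union> T. if \<chi> \<in> T then of_int (d \<chi>) * \<chi> g else 0)"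
      using S T by (intro sum.mono_neutral_cong_left) auto
    moreover have "(\<Sum>\<chi>\<in>S \<union> T. of_int (e \<chi>) * \<chi> g) = (\<Sum>\<chi>\<in>S \<union> T.
        (if \<chi> \<in> S then of_int (c \<chi>) * \<chi> g else 0) + (if \<chi> \<in> T then of_int (d \<chi>) * \<chi> g else 0))"
      by (intro sum.cong) (auto simp: e_def algebra_simps)
    ultimately show ?thesis by (simp only: sum.distrib)
  qed
  then show ?thesis
    unfolding gbc_eq \<phi> \<psi> using S T
    by (intro CollectI exI[of _ "S \<union> T"] exI[of _ e]) (auto intro!: restrict_ext)
qed

lemma gbc_of_int_mult:
  assumes "\<phi> \<in> gbc p M \<iota> G"
  shows "(\<lambda>g\<in>p_regular p G. of_int m * \<phi> g) \<in> gbc p M \<iota> G"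
proof -
  obtain S c where S: "finite S" "S \<subseteq> IBr p M \<iota> G"
      and \<phi>: "\<phi> = (\<lambda>g\<in>p_regular p G. \<Sum>\<chi>\<in>S. of_int (c \<chi>) * \<chi> g)"
    using assms(1) unfolding gbc_eq by auto
  show ?thesis
    unfolding gbc_eq \<phi> using S
    by (intro CollectI exI[of _ S] exI[of _ "\<lambda>\<chi>. m * c \<chi>"])
       (auto intro!: restrict_ext simp: sum_distrib_left mult.assoc)
qed

lemma gbc_sum:
  assumes "finite I" "\<And>i. i \<in> I \<Longrightarrow> f i \<in> gbc p M \<iota> G"
  shows "(\<lambda>g\<in>p_regular p G. \<Sum>i\<in>I. of_int (m i) * f i g) \<in> gbc p M \<iota> G"
  using assms
proof (induction I rule: finite_induct)
  case empty
  show ?case by (simp only: sum.empty gbc_zero)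
next
  case (insert i I)
  have "(\<lambda>g\<in>p_regular p G. \<Sum>i\<in>insert i I. of_int (m i) * f i g) =
      (\<lambda>g\<in>p_regular p G. (\<lambda>g\<in>p_regular p G. of_int (m i) * f i g) g +
         (\<lambda>g\<in>p_regular p G. \<Sum>i\<in>I. of_int (m i) * f i g) g)"
    using insert.hyps by (auto intro!: restrict_ext)
  then show ?case
    using gbc_add[OF gbc_of_int_mult[of "f i" p M \<iota> G "m i"] insert.IH] insert.prems
    by (simp only: insertI1 insertI2)
qed

text \<open>Strong induction on the degree: in degree 0 there are no eigenvalues, and a reducible
  representation splits into two of smaller degree whose eigenvalue multisets add up.\<close>

lemma (in group) brauer_character_in_gbc:
  "representation G n X \<Longrightarrow> brauer_character p M \<iota> G X \<in> gbc p M \<iota> G"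
proof (induction n arbitrary: X rule: less_induct)
  case (less n)
  consider "n = 0" | "irreducible_representation G n X" | "n > 0" "\<not> irreducible_representation G n X"
    by auto
  then show ?case
  proof cases
    case 1
    then have "char_poly (X g) = 1" if "g \<in> p_regular p G" for g
      using less.prems that by (auto simp: representation_iff p_regular_def char_poly_defs det_dim_zero)
    then have "brauer_character p M \<iota> G X = (\<lambda>g\<in>p_regular p G. 0)"
      by (auto simp: brauer_character_def intro!: restrict_ext)
    then show ?thesis by (simp only: gbc_zero)
  next
    case 2
    then show ?thesis by (intro gbc_IBr) (auto simp: IBr_def)
  next
    case 3
    then obtain k Y Z where k: "0 < k" "k < n" and YZ: "representation G k Y" "representation G (n - k) Z"
        and char_poly: "\<And>g. g \<in> carrier G \<Longrightarrow> char_poly (X g) = char_poly (Y g) * char_poly (Z g)"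
      using reducible_representation[OF less.prems] by metis
    \<comment> \<open>\<open>proots\<close> turns products into sums only for nonzero
      factors.\<close>
    have "char_poly (Y g) \<noteq> 0 \<and> char_poly (Z g) \<noteq> 0" if "g \<in> carrier G" for g
      using degree_monic_char_poly[of "Y g" k] degree_monic_char_poly[of "Z g" "n - k"] YZ that
      by (auto simp: representation_iff)
    then have "brauer_character p M \<iota> G X =
        (\<lambda>g\<in>p_regular p G. brauer_character p M \<iota> G Y g + brauer_character p M \<iota> G Z g)"
      by (auto simp: brauer_character_def p_regular_def char_poly proots_mult intro!: restrict_ext)
    moreover have "n - k < n" using k by simp
    ultimately show ?thesis
      using gbc_add[OF less.IH[OF k(2) YZ(1)] less.IH[OF _ YZ(2)]] by (simp only:)
  qed
qed

subsection \<open>Induction from cyclic subgroups\<close>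

definition mat_trace :: "'a::comm_ring_1 mat \<Rightarrow> 'a" where
  "mat_trace A = (\<Sum>i<dim_row A. A $$ (i, i))"

lemma mat_trace_commute:
  assumes A: "A \<in> carrier_mat n m" and B: "B \<in> carrier_mat m n"
  shows "mat_trace (A * B) = mat_trace (B * A)"
proof -
  have "mat_trace (A * B) = (\<Sum>i<n. \<Sum>j<m. A $$ (i, j) * B $$ (j, i))"
    using A B by (auto simp: mat_trace_def scalar_prod_def atLeast0LessThan intro!: sum.cong)
  also have "\<dots> = (\<Sum>j<m. \<Sum>i<n. B $$ (j, i) * A $$ (i, j))"
    by (subst sum.swap) (simp add: mult.commute)
  also have "\<dots> = mat_trace (B * A)"
    using A B by (auto simp: mat_trace_def scalar_prod_def atLeast0LessThan intro!: sum.cong)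
  finally show ?thesis .
qed

text \<open>A Schur decomposition gives a similar matrix with diagonal \<open>as\<close>, and the
  trace is invariant under similarity.\<close>

lemma mat_trace_eq_sum_list_roots:
  fixes A :: "complex mat"
  assumes A: "A \<in> carrier_mat n n" and char_poly: "char_poly A = (\<Prod>a\<leftarrow>as. [:- a, 1:])"
  shows "mat_trace A = sum_list as"
proof -
  obtain B P Q where schur: "schur_decomposition A as = (B, P, Q)"
    by (cases "schur_decomposition A as")
  have sim: "similar_mat_wit A B P Q" and diag: "diag_mat B = as"
    using schur_decomposition[OF A char_poly schur] by auto
  note s = similar_mat_witD2[OF A sim]
  have "mat_trace A = mat_trace (P * (B * Q))"
    using s by (simp add: assoc_mult_mat[of _ n n _ n _ n])
  also have "\<dots> = mat_trace (B * Q * P)"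
    using s by (intro mat_trace_commute[of _ n n]) auto
  also have "B * Q * P = B"
    using s by (simp add: assoc_mult_mat[of _ n n _ n _ n])
  also have "mat_trace B = sum_list (diag_mat B)"
    by (simp add: mat_trace_def diag_mat_def interv_sum_list_conv_sum_set_nat atLeast0LessThan)
  finally show ?thesis by (simp add: diag)
qed

text \<open>Allows a single matrix over the integer polynomials to be specialised both at a complex
  \<open>z\<close> and at its reduction, with the characteristic polynomial specialised along with
  it.\<close>

lemma comm_ring_hom_poly_of_int_poly: "comm_ring_hom (\<lambda>q. poly (of_int_poly q) z)"
  by unfold_locales (auto simp: hom_distribs)

lemma proots_prod_linear: "proots (\<Prod>a\<leftarrow>as. [:- a, 1:]) = mset (as :: 'a::idom list)"
proof (induction as)
  case (Cons a as)
  have "(\<Prod>a\<leftarrow>as. [:- a, 1:]) \<noteq> 0" by (auto simp: prod_list_zero_iff)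
  then have "proots ([:- a, 1:] * (\<Prod>a\<leftarrow>as. [:- a, 1:])) = proots [:- a, 1:] + proots (\<Prod>a\<leftarrow>as. [:- a, 1:])"
    by (intro proots_mult) auto
  then show ?case using Cons by (simp del: mult_pCons_left)
qed simp

text \<open>An eigenvector \<open>v\<close> for \<open>a\<close> satisfies
  \<open>v = a ^ N \<cdot>\<^sub>v v\<close>; any nonzero coordinate of \<open>v\<close> gives the
  claim.\<close>

lemma root_of_unity_char_poly:
  fixes A :: "'a::field mat"
  assumes A: "A \<in> carrier_mat n n" and pow: "A ^\<^sub>m N = 1\<^sub>m n" and root: "poly (char_poly A) a = 0"
  shows "a ^ N = 1"
proof -
  have "eigenvalue A a" using root eigenvalue_root_char_poly[OF A] by simp
  then obtain v where v: "eigenvector A v a" by (auto simp: eigenvalue_def)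
  then have v': "v \<in> carrier_vec n" "v \<noteq> 0\<^sub>v n" using A by (auto simp: eigenvector_def)
  have eq: "v = a ^ N \<cdot>\<^sub>v v" using eigenvector_pow[OF A v, of N] v' by (simp add: pow)
  obtain i where i: "i < n" "v $ i \<noteq> 0" using v' by (metis carrier_vecD eq_vecI index_zero_vec)
  have "v $ i = a ^ N * v $ i" using arg_cong[OF eq, of "\<lambda>w. w $ i"] i v' by simp
  then show ?thesis using i by simp
qed

context modular_reduction
begin

lemma red_poly_of_int_poly:
  assumes "algebraic_int z"
  shows "algebraic_int (poly (of_int_poly q) z) \<and> red (poly (of_int_poly q) z) = poly (of_int_poly q) (red z)"
  using assms by (induction q) (auto simp: red_add red_mult algebraic_int_add algebraic_int_mult)

text \<open>Reduction respects sums and products only of algebraic integers, so integrality of the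
  coefficients has to be carried along with the product formula.\<close>

lemma map_poly_red_linear_mult:
  assumes "algebraic_int a" "\<And>i. algebraic_int (coeff q i)"
  shows "map_poly red ([:- a, 1:] * q) = [:- red a, 1:] * map_poly red q"
    and "algebraic_int (coeff ([:- a, 1:] * q) i)"
proof -
  \<comment> \<open>Stated over an arbitrary commutative ring because it is applied to complex
    polynomials and to polynomials over the residue field.\<close>
  have *: "coeff ([:- b, 1:] * r) i = (case i of 0 \<Rightarrow> 0 | Suc j \<Rightarrow> coeff r j) + - (b * coeff r i)"
    for b :: "'c::comm_ring_1" and r i by (simp add: coeff_pCons split: nat.split)
  show "algebraic_int (coeff ([:- a, 1:] * q) i)"
    unfolding * using assms by (auto intro!: algebraic_int_diff algebraic_int_mult split: nat.split)
  show "map_poly red ([:- a, 1:] * q) = [:- red a, 1:] * map_poly red q"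
    by (rule poly_eqI, subst coeff_map_poly, simp, unfold *)
       (use assms in \<open>auto simp: coeff_map_poly red_diff red_minus red_mult algebraic_int_mult split: nat.split\<close>)
qed

lemma map_poly_red_prod_linear:
  assumes "\<And>a. a \<in> set as \<Longrightarrow> algebraic_int a"
  shows "map_poly red (\<Prod>a\<leftarrow>as. [:- a, 1:]) = (\<Prod>a\<leftarrow>as. [:- red a, 1:]) \<and>
    (\<forall>i. algebraic_int (coeff (\<Prod>a\<leftarrow>as. [:- a, 1:]) i))"
  using assms
proof (induction as)
  case Nil
  then show ?case by (auto simp: coeff_1)
next
  case (Cons a as)
  then show ?case
    using map_poly_red_linear_mult[of a "\<Prod>a\<leftarrow>as. [:- a, 1:]"] by simp
qed

text \<open>The bridge between the characteristics. The eigenvalues of the complex specialisation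
  are roots of unity of order prime to \<open>p\<close>, and their reductions are the eigenvalues of
  the specialisation at \<open>red z\<close>. Lifting therefore recovers the complex eigenvalues,
  whose sum is the trace.\<close>

lemma sum_root_lift_char_poly:
  assumes B: "B \<in> carrier_mat m m" and z: "algebraic_int z" and N: "N > 0" "coprime N p"
    and pow: "map_mat (\<lambda>q. poly (of_int_poly q) z) B ^\<^sub>m N = 1\<^sub>m m"
  shows "(\<Sum>a\<in>#proots (char_poly (map_mat (\<lambda>q. poly (of_int_poly q) (red z)) B)). root_lift p M \<iota> a) =
    mat_trace (map_mat (\<lambda>q. poly (of_int_poly q) z) B)"
proof -
  define A where "A = map_mat (\<lambda>q. poly (of_int_poly q) z) B"
  have A: "A \<in> carrier_mat m m" using B by (simp add: A_def)
  obtain as where as: "char_poly A = (\<Prod>a\<leftarrow>as. [:- a, 1:])"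
    using char_poly_factorized[OF A] by auto
  have "a ^ N = 1" if "a \<in> set as" for a
    using that pow[folded A_def]
    by (intro root_of_unity_char_poly[OF A]) (auto simp: as poly_prod_list prod_list_zero_iff)
  then have roots: "a \<in> p'_roots_of_unity p" "algebraic_int a" if "a \<in> set as" for a
    using that N by (auto simp: p'_roots_of_unity_def intro: algebraic_int_root_of_unity)
  have "char_poly (map_mat (\<lambda>q. poly (of_int_poly q) (red z)) B) =
      map_poly (\<lambda>q. poly (of_int_poly q) (red z)) (char_poly B)"
    by (rule comm_ring_hom.char_poly_hom[OF comm_ring_hom_poly_of_int_poly B])
  also have "\<dots> = map_poly red (map_poly (\<lambda>q. poly (of_int_poly q) z) (char_poly B))"
    using red_poly_of_int_poly[OF z] by (intro poly_eqI) (simp add: coeff_map_poly)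
  also have "map_poly (\<lambda>q. poly (of_int_poly q) z) (char_poly B) = char_poly A"
    unfolding A_def
    by (rule comm_ring_hom.char_poly_hom[OF comm_ring_hom_poly_of_int_poly B, symmetric])
  also have "map_poly red (char_poly A) = (\<Prod>a\<leftarrow>as. [:- red a, 1:])"
    unfolding as using map_poly_red_prod_linear roots by blast
  finally have "proots (char_poly (map_mat (\<lambda>q. poly (of_int_poly q) (red z)) B)) = mset (map red as)"
    using proots_prod_linear[of "map red as"] by (simp add: o_def)
  then have "(\<Sum>a\<in>#proots (char_poly (map_mat (\<lambda>q. poly (of_int_poly q) (red z)) B)). root_lift p M \<iota> a) =
      sum_list (map (\<lambda>a. root_lift p M \<iota> (red a)) as)"
    by (simp only: mset_map[symmetric] sum_mset_sum_list map_map o_def)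
  also have "map (\<lambda>a. root_lift p M \<iota> (red a)) as = as"
    using roots by (intro map_idI root_lift_red)
  finally show ?thesis
    using mat_trace_eq_sum_list_roots[OF A as] by (simp add: A_def)
qed

end

text \<open>The \<open>t i\<close> represent the left cosets of the cyclic subgroup generated by
  \<open>x\<close>; \<open>idx g\<close> is the number of the coset of \<open>g\<close>, and
  \<open>lg g\<close> is an exponent locating \<open>g\<close> in it, determined only modulo
  \<open>ord x\<close>.\<close>

locale cyclic_transversal = group G for G (structure) +
  fixes x :: 'a and m :: nat and t :: "nat \<Rightarrow> 'a" and idx lg :: "'a \<Rightarrow> nat"
  assumes x: "x \<in> carrier G" and t: "i < m \<Longrightarrow> t i \<in> carrier G"
    and idx: "g \<in> carrier G \<Longrightarrow> idx g < m"
    and decomp: "g \<in> carrier G \<Longrightarrow> g = t (idx g) \<otimes> x [^] lg g"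
    and unique: "i < m \<Longrightarrow> j < m \<Longrightarrow> t i \<otimes> x [^] (e::nat) = t j \<otimes> x [^] (f::nat) \<Longrightarrow> i = j"
begin

lemma idx_lg_eqI:
  assumes "i < m" "g = t i \<otimes> x [^] (e::nat)"
  shows "idx g = i" and "lg g mod ord x = e mod ord x"
proof -
  have g: "g \<in> carrier G" using assms t x by simp
  show i: "idx g = i"
    using unique[of "idx g" i "lg g" e] idx[OF g] decomp[OF g] assms by simp
  have "t i \<otimes> x [^] lg g = t i \<otimes> x [^] e" using decomp[OF g] i assms by simp
  then have eq: "x [^] lg g = x [^] e" using assms(1) t x by simp
  \<comment> \<open>Subtraction of naturals is truncated, so both differences are treated; the
    larger exponent decides which one carries the information.\<close>
  have "ord x dvd lg g - e" "ord x dvd e - lg g"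
    using pow_eq_div2[OF x eq] pow_eq_div2[OF x eq[symmetric]] x by (simp_all add: pow_eq_id)
  then show "lg g mod ord x = e mod ord x"
    by (metis mod_eq_dvd_iff_nat nat_le_linear)
qed

text \<open>
  The matrices of the representation of \<open>G\<close> induced from the linear character \<open>x \<mapsto> z\<close> of \<open>\<langle>x\<rangle>\<close>,
  provided that \<open>z ^ ord x = 1\<close>; for \<open>z = [:0, 1:]\<close> they specialise to both characteristics at once.
\<close>

definition induced :: "'c::comm_ring_1 \<Rightarrow> 'a \<Rightarrow> 'c mat" where
  "induced z y = mat m m (\<lambda>(i, k). if i = idx (y \<otimes> t k) then z ^ lg (y \<otimes> t k) else 0)"

lemma power_mod_ord:
  fixes z :: "'c::comm_ring_1"
  assumes "z ^ ord x = 1" "a mod ord x = b mod ord x" shows "z ^ a = z ^ b"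
proof -
  have "z ^ c = z ^ (c mod ord x)" for c
  proof -
    have "z ^ c = z ^ (ord x * (c div ord x) + c mod ord x)" by simp
    also have "\<dots> = z ^ (c mod ord x)"
      by (simp only: power_add power_mult assms(1) power_one mult_1)
    finally show ?thesis .
  qed
  then show ?thesis using assms(2) by metis
qed

text \<open>Column \<open>k\<close> of \<open>induced z h\<close> has its only possibly nonzero
  entry in row \<open>idx (h \<otimes> t k)\<close>. In a product the coset permutations compose and
  the exponents add, while \<open>z ^ ord x = 1\<close> makes the choice of exponents
  immaterial.\<close>

lemma representation_induced:
  fixes z :: "'c::field"
  assumes z: "z ^ ord x = 1"
  shows "representation G m (induced z)"
  unfolding representation_iff
proof (intro conjI ballI)
  fix g h assume g: "g \<in> carrier G" and h: "h \<in> carrier G"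
  show "induced z g \<in> carrier_mat m m" by (simp add: induced_def)
  show "induced z (g \<otimes> h) = induced z g * induced z h"
  proof (rule eq_matI)
    fix i k assume "i < dim_row (induced z g * induced z h)" "k < dim_col (induced z g * induced z h)"
    then have ik: "i < m" "k < m" by (simp_all add: induced_def)
    define l where "l = idx (h \<otimes> t k)"
    have hk: "h \<otimes> t k \<in> carrier G" and l: "l < m" and gl: "g \<otimes> t l \<in> carrier G"
      using g h t ik idx by (auto simp: l_def)
    have "g \<otimes> h \<otimes> t k = g \<otimes> (h \<otimes> t k)"
      using g h t ik by (simp add: m_assoc)
    also have "\<dots> = g \<otimes> (t l \<otimes> x [^] lg (h \<otimes> t k))"
      using decomp[OF hk] by (simp add: l_def)
    also have "\<dots> = g \<otimes> t l \<otimes> x [^] lg (h \<otimes> t k)"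
      using g t l x by (simp add: m_assoc)
    also have "\<dots> = t (idx (g \<otimes> t l)) \<otimes> x [^] lg (g \<otimes> t l) \<otimes> x [^] lg (h \<otimes> t k)"
      using decomp[OF gl] by simp
    also have "\<dots> = t (idx (g \<otimes> t l)) \<otimes> x [^] (lg (g \<otimes> t l) + lg (h \<otimes> t k))"
      using t idx gl x by (simp add: m_assoc nat_pow_mult)
    finally have eq: "g \<otimes> h \<otimes> t k = t (idx (g \<otimes> t l)) \<otimes> x [^] (lg (g \<otimes> t l) + lg (h \<otimes> t k))" .
    have "(induced z g * induced z h) $$ (i, k) =
        (\<Sum>j<m. induced z g $$ (i, j) * induced z h $$ (j, k))"
      using ik by (simp add: induced_def scalar_prod_def atLeast0LessThan)
    also have "\<dots> = (\<Sum>j<m. if j = l then induced z g $$ (i, l) * z ^ lg (h \<otimes> t k) else 0)"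
      using ik by (intro sum.cong) (auto simp: induced_def l_def)
    also have "\<dots> = induced z g $$ (i, l) * z ^ lg (h \<otimes> t k)"
      using l by simp
    also have "\<dots> = induced z (g \<otimes> h) $$ (i, k)"
      using ik l idx_lg_eqI[OF idx[OF gl] eq] power_mod_ord[OF z idx_lg_eqI(2)[OF idx[OF gl] eq]]
      by (simp add: induced_def power_add)
    finally show "induced z (g \<otimes> h) $$ (i, k) = (induced z g * induced z h) $$ (i, k)" by simp
  qed (simp_all add: induced_def)
next
  show "induced z \<one> = 1\<^sub>m m"
  proof (rule eq_matI)
    fix i k assume "i < dim_row (1\<^sub>m m :: 'c mat)" "k < dim_col (1\<^sub>m m :: 'c mat)"
    then have ik: "i < m" "k < m" by simp_all
    have "\<one> \<otimes> t k = t k \<otimes> x [^] (0::nat)" using ik t by simp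
    note * = idx_lg_eqI[OF ik(2) this]
    show "induced z \<one> $$ (i, k) = 1\<^sub>m m $$ (i, k)"
      using ik * power_mod_ord[OF z *(2)] by (simp add: induced_def)
  qed (simp_all add: induced_def)
qed

lemma induced_power:
  fixes z :: "'c::field"
  assumes "z ^ ord x = 1" "y \<in> carrier G"
  shows "induced z y ^\<^sub>m N = induced z (y [^] N)"
  using representation_induced[OF assms(1)] assms(2)
  by (induction N) (auto simp: representation_iff)

lemma map_mat_induced:
  "map_mat (\<lambda>q. poly (of_int_poly q) z) (induced [:0, 1:] y) = induced z y"
  by (rule eq_matI) (auto simp: induced_def hom_distribs)

text \<open>The cosets fixed under left multiplication by \<open>y\<close>, which are those
  contributing to the diagonal of \<open>induced z y\<close>.\<close>

definition fixed :: "'a \<Rightarrow> nat set" where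
  "fixed y = {k. k < m \<and> idx (y \<otimes> t k) = k}"

lemma finite_fixed: "finite (fixed y)" by (simp add: fixed_def)

lemma fixedD:
  assumes "k \<in> fixed y" "y \<in> carrier G"
  shows "t k \<in> carrier G" "y \<otimes> t k = t k \<otimes> x [^] lg (y \<otimes> t k)"
  using assms t decomp[of "y \<otimes> t k"] by (auto simp: fixed_def)

lemma mat_trace_induced: "mat_trace (induced z y) = (\<Sum>k\<in>fixed y. z ^ lg (y \<otimes> t k))"
proof -
  have "mat_trace (induced z y) = (\<Sum>k<m. if idx (y \<otimes> t k) = k then z ^ lg (y \<otimes> t k) else 0)"
    by (auto simp: mat_trace_def induced_def intro!: sum.cong)
  also have "\<dots> = (\<Sum>k\<in>fixed y. z ^ lg (y \<otimes> t k))"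
    by (simp add: fixed_def sum.If_cases Collect_conj_eq lessThan_def)
  finally show ?thesis .
qed

text \<open>The representative of the coset of \<open>\<one>\<close> is the inverse of a power of
  \<open>x\<close> and so commutes with \<open>x\<close>. Reducing 1 modulo \<open>ord x\<close>
  covers the case of trivial \<open>x\<close>.\<close>

lemma fixed_self: "\<exists>k\<in>fixed x. lg (x \<otimes> t k) mod ord x = 1 mod ord x"
proof -
  define k where "k = idx \<one>"
  have k: "k < m" by (simp add: k_def idx)
  have "t k \<otimes> x [^] lg \<one> = \<one>" using decomp[of \<one>] by (simp add: k_def)
  then have tk: "t k = inv (x [^] lg \<one>)"
    using t[OF k] x by (metis inv_equality nat_pow_closed)
  have "x [^] lg \<one> \<otimes> x = x \<otimes> x [^] lg \<one>"
    using x nat_pow_Suc2[OF x, of "lg \<one>"] by simp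
  then have "x \<otimes> t k = t k \<otimes> x"
    unfolding tk using x by (metis inv_solve_left inv_solve_right m_assoc inv_closed m_closed nat_pow_closed)
  then have "x \<otimes> t k = t k \<otimes> x [^] (1::nat)" using x by simp
  from idx_lg_eqI[OF k this] show ?thesis using k by (auto simp: fixed_def)
qed

end

text \<open>The chosen representative \<open>rep g\<close> depends only on the coset
  \<open>C g\<close>, hence is constant on cosets; the finite set of representatives is then
  enumerated by \<open>t\<close>.\<close>

lemma (in group) cyclic_transversal_exists:
  assumes fin: "finite (carrier G)" and x: "x \<in> carrier G"
  shows "\<exists>m t idx lg. cyclic_transversal G x m t idx lg"
proof -
  define C where "C g = {g \<otimes> x [^] (e::nat) | e. True}" for g
  define rep where "rep g = (SOME h. h \<in> C g)" for g
  have self: "g \<in> C g" if "g \<in> carrier G" for g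
    using that x by (auto simp: C_def intro!: exI[of _ 0])
  have rep: "rep g \<in> C g" if "g \<in> carrier G" for g
    unfolding rep_def using self[OF that] by (rule someI)
  have C_mult: "C (g \<otimes> x [^] (e::nat)) = C g" if g: "g \<in> carrier G" for g e
  proof (intro equalityI subsetI)
    fix h assume "h \<in> C (g \<otimes> x [^] e)"
    then show "h \<in> C g" using g x by (auto simp: C_def m_assoc nat_pow_mult)
  next
    fix h assume "h \<in> C g"
    then obtain f where h: "h = g \<otimes> x [^] (f::nat)" by (auto simp: C_def)
    have n: "ord x > 0" using ord_ge_1[OF fin x] by simp
    \<comment> \<open>Cosets are formed with natural exponents; the power
      \<open>(ord x - 1) * e\<close> plays the role of the exponent \<open>- e\<close>.\<close>
    have "x [^] (e + (f + (ord x - 1) * e)) = x [^] (f + ord x * e)"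
      using n by (intro arg_cong[where f = "\<lambda>k. x [^] (k::nat)"]) (cases "ord x", auto)
    also have "\<dots> = x [^] f" using x by (simp add: nat_pow_mult[symmetric] nat_pow_pow[symmetric])
    finally have "h = g \<otimes> x [^] e \<otimes> x [^] (f + (ord x - 1) * e)"
      using g x by (simp add: h m_assoc nat_pow_mult)
    then show "h \<in> C (g \<otimes> x [^] e)" by (auto simp: C_def)
  qed
  have C_eq: "C h = C g" if "g \<in> carrier G" "h \<in> C g" for g h
  proof -
    obtain e :: nat where "h = g \<otimes> x [^] e" using \<open>h \<in> C g\<close> unfolding C_def by blast
    then show ?thesis using C_mult[OF \<open>g \<in> carrier G\<close>] by simp
  qed
  have rep_eq: "rep h = rep g" if "g \<in> carrier G" "h \<in> C g" for g h
    using C_eq[OF that] by (simp add: rep_def)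
  have memC: "a \<otimes> x [^] (e::nat) \<in> C a" for a e
    by (auto simp: C_def)
  have C_carrier: "h \<in> carrier G" if "g \<in> carrier G" "h \<in> C g" for g h
    using that x by (auto simp: C_def)
  define T where "T = rep ` carrier G"
  have finT: "finite T" using fin by (simp add: T_def)
  have T: "a \<in> carrier G \<and> rep a = a" if "a \<in> T" for a
    using that rep C_carrier rep_eq by (force simp: T_def)
  obtain t where t: "bij_betw t {0..<card T} T"
    using ex_bij_betw_nat_finite[OF finT] by auto
  define idx where "idx g = the_inv_into {0..<card T} t (rep g)" for g
  have t_idx: "idx g < card T \<and> t (idx g) = rep g" if "g \<in> carrier G" for g
    using that t f_the_inv_into_f_bij_betw[OF t, of "rep g"]
      bij_betw_apply[OF bij_betw_the_inv_into[OF t], of "rep g"]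
    by (auto simp: idx_def T_def)
  have "\<exists>e::nat. g = rep g \<otimes> x [^] e" if g: "g \<in> carrier G" for g
    using self[OF g] C_eq[OF g rep[OF g]] by (auto simp: C_def)
  then obtain lg :: "'a \<Rightarrow> nat" where lg: "\<And>g. g \<in> carrier G \<Longrightarrow> g = rep g \<otimes> x [^] lg g" by metis
  have tT: "t i \<in> T" if "i < card T" for i using bij_betw_apply[OF t, of i] that by simp
  have "cyclic_transversal G x (card T) t idx lg"
  proof (unfold_locales)
    fix i j e f assume ij: "i < card T" "j < card T" and eq: "t i \<otimes> x [^] (e::nat) = t j \<otimes> x [^] (f::nat)"
    have "rep (t i) = rep (t i \<otimes> x [^] e)" "rep (t j) = rep (t j \<otimes> x [^] f)"
      using rep_eq[OF _ memC] T[OF tT] ij by metis+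
    then have "t i = t j" using T[OF tT] ij eq by simp
    then show "i = j" using t ij by (auto simp: bij_betw_def inj_on_def)
  qed (use x T tT t_idx lg in auto)
  then show ?thesis by blast
qed

subsection \<open>Generalized Brauer characters as class functions\<close>

lemma ex_primitive_root_of_unity:
  assumes "n > 0"
  obtains \<zeta> :: complex where "\<And>k. \<zeta> ^ k = 1 \<longleftrightarrow> n dvd k"
proof
  fix k
  have "cis (2 * pi / n) ^ k = 1 \<longleftrightarrow> cos (2 * pi * k / n) = 1"
    by (auto simp: DeMoivre complex_eq_iff mult_ac cos_one_sin_zero)
  also have "\<dots> \<longleftrightarrow> (\<exists>l::int. 2 * pi * k / n = l * 2 * pi)"
    by (rule cos_one_2pi_int)
  also have "\<dots> \<longleftrightarrow> (\<exists>l::int. int k = l * int n)"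
  proof -
    have "2 * pi * k / n = l * 2 * pi \<longleftrightarrow> int k = l * int n" for l :: int
    proof -
      have "2 * pi * k / n = l * 2 * pi \<longleftrightarrow> real k = real_of_int l * real n"
        using assms by (auto simp: field_simps)
      also have "\<dots> \<longleftrightarrow> real_of_int (int k) = real_of_int (l * int n)" by simp
      also have "\<dots> \<longleftrightarrow> int k = l * int n" by (rule of_int_eq_iff)
      finally show ?thesis .
    qed
    then show ?thesis by simp
  qed
  also have "\<dots> \<longleftrightarrow> n dvd k"
    by (metis dvd_def dvd_triv_right int_dvd_int_iff mult.commute)
  finally show "cis (2 * pi / n) ^ k = 1 \<longleftrightarrow> n dvd k" .
qed

lemma (in group) conj_pow:
  assumes x: "x \<in> carrier G" and g: "g \<in> carrier G"
  shows "(g \<otimes> x \<otimes> inv g) [^] (k::nat) = g \<otimes> x [^] k \<otimes> inv g"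
proof (induction k)
  case (Suc k)
  have "(g \<otimes> x \<otimes> inv g) [^] Suc k = g \<otimes> x [^] k \<otimes> inv g \<otimes> (g \<otimes> x \<otimes> inv g)"
    using Suc by simp
  also have "\<dots> = g \<otimes> x [^] k \<otimes> (inv g \<otimes> g) \<otimes> x \<otimes> inv g"
    using x g by (simp only: m_assoc m_closed inv_closed nat_pow_closed)
  also have "\<dots> = g \<otimes> x [^] k \<otimes> \<one> \<otimes> x \<otimes> inv g"
    using g by (simp only: l_inv)
  finally show ?case using x g by (simp add: m_assoc)
qed (use g in simp)

lemma (in group) p_regular_conj:
  assumes "x \<in> p_regular p G" "g \<in> carrier G"
  shows "g \<otimes> x \<otimes> inv g \<in> p_regular p G"
proof -
  have x: "x \<in> carrier G" using assms by (simp add: p_regular_def)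
  let ?y = "g \<otimes> x \<otimes> inv g"
  have y: "?y \<in> carrier G" using x assms by simp
  have "?y [^] k = \<one> \<longleftrightarrow> x [^] k = \<one>" for k :: nat
    unfolding conj_pow[OF x assms(2)] using x assms(2)
    by (metis inv_closed inv_inv inv_solve_right' l_cancel_one' l_one m_closed nat_pow_closed one_closed r_cancel_one' r_inv)
  then have "ord ?y dvd k \<longleftrightarrow> ord x dvd k" for k :: nat
    using x y by (simp add: pow_eq_id)
  then have "ord ?y = ord x" by (metis dvd_antisym dvd_refl)
  then show ?thesis using assms y by (simp add: p_regular_def)
qed

text \<open>Conjugate elements act by similar matrices, so their characteristic polynomials, and
  hence the values of every irreducible Brauer character, agree.\<close>

lemma (in group) gbc_conj:
  assumes f: "f \<in> gbc p M \<iota> G" and x: "x \<in> p_regular p G" and g: "g \<in> carrier G"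
  shows "f (g \<otimes> x \<otimes> inv g) = f x"
proof -
  have xG: "x \<in> carrier G" using x by (simp add: p_regular_def)
  have "\<phi> (g \<otimes> x \<otimes> inv g) = \<phi> x" if \<phi>_in: "\<phi> \<in> IBr p M \<iota> G" for \<phi>
  proof -
    obtain n X where \<phi>: "\<phi> = brauer_character p M \<iota> G X" and "irreducible_representation G n X"
      using \<phi>_in by (auto simp: IBr_def)
    then have rep: "\<forall>g\<in>carrier G. X g \<in> carrier_mat n n" "X \<one> = 1\<^sub>m n"
        "\<forall>g\<in>carrier G. \<forall>h\<in>carrier G. X (g \<otimes> h) = X g * X h"
      by (auto simp: irreducible_representation_def representation_iff)
    have inv: "X g * X (inv g) = 1\<^sub>m n" "X (inv g) * X g = 1\<^sub>m n"
      using rep(2,3) g by (metis inv_closed r_inv, metis inv_closed l_inv)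
    have "similar_mat_wit (X (g \<otimes> x \<otimes> inv g)) (X x) (X g) (X (inv g))"
      by (rule similar_mat_witI[OF inv]) (use rep g xG in \<open>auto intro!: mult_carrier_mat\<close>)
    then have "similar_mat (X (g \<otimes> x \<otimes> inv g)) (X x)"
      unfolding similar_mat_def by blast
    then show ?thesis
      using p_regular_conj[OF x g] x by (simp add: \<phi> brauer_character_def char_poly_similar)
  qed
  moreover obtain S c where "finite S" "S \<subseteq> IBr p M \<iota> G"
      "f = (\<lambda>g\<in>p_regular p G. \<Sum>\<chi>\<in>S. of_int (c \<chi>) * \<chi> g)"
    using f unfolding gbc_eq by auto
  ultimately show ?thesis
    using p_regular_conj[OF x g] x by (auto intro!: sum.cong)
qed

text \<open>The representation induced from \<open>x \<mapsto> red (\<zeta> ^ j)\<close> has a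
  Brauer character \<open>f j\<close> given by a complex monomial trace. Weighting the
  \<open>f j\<close> with the coefficients of \<open>q\<close> and interchanging the sums evaluates
  \<open>q\<close> at powers of \<open>\<zeta>\<close>.\<close>

lemma (in modular_reduction) induced_in_gbc:
  fixes G (structure)
  assumes "cyclic_transversal G x m t idx lg" and fin: "finite (carrier G)" and reg: "x \<in> p_regular p G"
    and \<zeta>: "\<zeta> ^ group.ord G x = 1"
  shows "(\<lambda>y\<in>p_regular p G. \<Sum>k\<in>cyclic_transversal.fixed G m t idx y.
            poly (of_int_poly q) (\<zeta> ^ lg (y \<otimes> t k))) \<in> gbc p M \<iota> G"
proof -
  interpret cyclic_transversal G x m t idx lg by fact
  have algebraic: "algebraic_int (\<zeta> ^ j)" for j
    using algebraic_int_root_of_unity[OF \<zeta>] ord_ge_1[OF fin x] red_power by simp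
  have pow: "(\<zeta> ^ j) ^ ord x = 1" for j
    by (metis \<zeta> power_mult mult.commute power_one)
  have red_pow: "red (\<zeta> ^ j) ^ ord x = 1" for j
    using red_power[OF algebraic, of j "ord x"] pow by simp
  define f where "f j = brauer_character p M \<iota> G (induced (red (\<zeta> ^ j)))" for j
  have f_in: "f j \<in> gbc p M \<iota> G" for j
    unfolding f_def using representation_induced[OF red_pow] by (rule brauer_character_in_gbc)
  have f: "f j y = (\<Sum>k\<in>fixed y. (\<zeta> ^ lg (y \<otimes> t k)) ^ j)" if y: "y \<in> p_regular p G" for j y
  proof -
    have yG: "y \<in> carrier G" and "\<not> p dvd ord y" using y by (auto simp: p_regular_def)
    then have cop: "coprime (ord y) p"
      using prime by (metis coprime_commute prime_imp_coprime)
    have "f j y = (\<Sum>a\<in>#proots (char_poly (map_mat (\<lambda>q. poly (of_int_poly q) (red (\<zeta> ^ j))) (induced [:0, 1:] y))).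
        root_lift p M \<iota> a)"
      using y by (simp add: f_def brauer_character_def map_mat_induced)
    also have "\<dots> = mat_trace (map_mat (\<lambda>q. poly (of_int_poly q) (\<zeta> ^ j)) (induced [:0, 1:] y))"
    proof (rule sum_root_lift_char_poly[where m = m and N = "ord y"])
      show "induced [:0, 1:] y \<in> carrier_mat m m" by (simp add: induced_def)
      show "map_mat (\<lambda>q. poly (of_int_poly q) (\<zeta> ^ j)) (induced [:0, 1:] y) ^\<^sub>m ord y = 1\<^sub>m m"
        using representation_induced[OF pow, of j] yG
        by (simp add: map_mat_induced induced_power[OF pow yG] representation_iff)
    qed (use algebraic cop ord_ge_1[OF fin yG] in auto)
    also have "\<dots> = (\<Sum>k\<in>fixed y. (\<zeta> ^ lg (y \<otimes> t k)) ^ j)"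
      by (simp add: map_mat_induced mat_trace_induced power_mult[symmetric] mult.commute)
    finally show ?thesis .
  qed
  have "(\<Sum>k\<in>fixed y. poly (of_int_poly q) (\<zeta> ^ lg (y \<otimes> t k))) = (\<Sum>j\<le>degree q. of_int (coeff q j) * f j y)"
    if "y \<in> p_regular p G" for y
    using that
    by (simp add: f poly_altdef sum_distrib_left)
       (subst sum.swap, simp)
  then show ?thesis
    using gbc_sum[of "{..degree q}" f p M \<iota> G "coeff q"] f_in
    by (auto simp: restrict_def cong: if_cong)
qed

lemma (in group) pow_mod_eq:
  assumes "x \<in> carrier G" "a mod ord x = b mod ord x"
  shows "x [^] (a::nat) = x [^] b"
proof -
  have "x [^] c = x [^] (c mod ord x)" for c :: nat
  proof -
    have "x [^] c = x [^] (ord x * (c div ord x) + c mod ord x)" by simp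
    also have "\<dots> = x [^] (c mod ord x)"
      using assms(1) pow_eq_id[OF assms(1), of "ord x * (c div ord x)"]
      by (subst nat_pow_mult[symmetric]) auto
    finally show ?thesis .
  qed
  then show ?thesis using assms(2) by metis
qed

text \<open>For \<open>v\<close> equal to \<open>x\<close> or \<open>y\<close>, count the cosets
  whose representative satisfies \<open>v \<otimes> t k = t k \<otimes> x\<close>. The two counts
  agree, and the one for \<open>x\<close> is positive by \<open>fixed_self\<close>, so some
  \<open>t k\<close> conjugates \<open>x\<close> to \<open>y\<close>.\<close>

lemma (in modular_reduction) gbc_separates:
  fixes G (structure)
  assumes "group G" and fin: "finite (carrier G)"
    and x_reg: "x \<in> p_regular p G" and y: "y \<in> p_regular p G"
    and eq: "\<And>f. f \<in> gbc p M \<iota> G \<Longrightarrow> f x = f y"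
  shows "\<exists>g\<in>carrier G. y = g \<otimes> x \<otimes> inv g"
proof -
  interpret group G by fact
  have xG: "x \<in> carrier G" and yG: "y \<in> carrier G" using x_reg y by (auto simp: p_regular_def)
  obtain m t idx lg where ct: "cyclic_transversal G x m t idx lg"
    using cyclic_transversal_exists[OF fin xG] by blast
  interpret cyclic_transversal G x m t idx lg by (rule ct)
  define n where "n = ord x"
  have n: "n > 0" using ord_ge_1[OF fin xG] by (simp add: n_def)
  obtain \<zeta> :: complex where \<zeta>: "\<And>k. \<zeta> ^ k = 1 \<longleftrightarrow> n dvd k"
    using ex_primitive_root_of_unity[OF n] by metis
  have \<zeta>n: "\<zeta> ^ ord x = 1" using \<zeta> by (simp add: n_def)
  have \<zeta>_eq: "\<zeta> ^ a = \<zeta> ^ b \<longleftrightarrow> a mod n = b mod n" for a b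
  proof -
    have \<zeta>0: "\<zeta> \<noteq> 0" using \<zeta>[of n] n by (auto simp: power_0_left)
    have *: "\<zeta> ^ a = \<zeta> ^ b \<longleftrightarrow> a mod n = b mod n" if "a \<le> b" for a b
    proof -
      have "\<zeta> ^ b = \<zeta> ^ a * \<zeta> ^ (b - a)" using that by (simp flip: power_add)
      then have "\<zeta> ^ a = \<zeta> ^ b \<longleftrightarrow> \<zeta> ^ (b - a) = 1" using \<zeta>0 by auto
      then show ?thesis using that \<zeta> by (metis mod_eq_dvd_iff_nat)
    qed
    show ?thesis using *[of a b] *[of b a] by (cases "a \<le> b") auto
  qed
  have int_poly_eq: "(\<Sum>k\<in>fixed x. poly (of_int_poly q) (\<zeta> ^ lg (x \<otimes> t k))) =
      (\<Sum>k\<in>fixed y. poly (of_int_poly q) (\<zeta> ^ lg (y \<otimes> t k)))" for q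
    using eq[OF induced_in_gbc[OF ct fin x_reg \<zeta>n, of q]] x_reg y by simp
  have pow_eq: "(\<Sum>k\<in>fixed x. (\<zeta> ^ lg (x \<otimes> t k)) ^ j) = (\<Sum>k\<in>fixed y. (\<zeta> ^ lg (y \<otimes> t k)) ^ j)" for j
    using int_poly_eq[of "monom 1 j"] by (simp add: poly_monom)
  \<comment> \<open>Integer polynomials supply the equality for each monomial, and linearity extends
    it to complex coefficients, so Lagrange-style interpolation becomes available.\<close>
  have poly_eq: "(\<Sum>k\<in>fixed x. poly q (\<zeta> ^ lg (x \<otimes> t k))) = (\<Sum>k\<in>fixed y. poly q (\<zeta> ^ lg (y \<otimes> t k)))" for q
  proof -
    have "(\<Sum>k\<in>fixed v. poly q (\<zeta> ^ lg (v \<otimes> t k))) =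
        (\<Sum>j\<le>degree q. coeff q j * (\<Sum>k\<in>fixed v. (\<zeta> ^ lg (v \<otimes> t k)) ^ j))" for v
      by (simp only: poly_altdef sum_distrib_left) (rule sum.swap)
    then show ?thesis using pow_eq by simp
  qed
  \<comment> \<open>an interpolation polynomial at the powers of \<open>\<zeta>\<close>, nonzero at \<open>\<zeta>\<close> only\<close>
  define q where "q = (\<Prod>w\<in>(\<lambda>e. \<zeta> ^ e) ` {..<n} - {\<zeta>}. [:- w, 1:])"
  have q0: "poly q (\<zeta> ^ e) = 0 \<longleftrightarrow> e mod n \<noteq> 1 mod n" for e
  proof -
    have "poly q (\<zeta> ^ e) = 0 \<longleftrightarrow> \<zeta> ^ e \<in> (\<lambda>e. \<zeta> ^ e) ` {..<n} - {\<zeta>}"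
      by (auto simp: q_def poly_prod prod_zero_iff)
    also have "\<zeta> ^ e \<in> (\<lambda>e. \<zeta> ^ e) ` {..<n}"
      using n by (intro image_eqI[of _ _ "e mod n"]) (auto simp: \<zeta>_eq)
    then have "\<zeta> ^ e \<in> (\<lambda>e. \<zeta> ^ e) ` {..<n} - {\<zeta>} \<longleftrightarrow> \<zeta> ^ e \<noteq> \<zeta> ^ 1" by auto
    finally show ?thesis unfolding \<zeta>_eq .
  qed
  have q_val: "poly q (\<zeta> ^ e) = (if e mod n = 1 mod n then poly q \<zeta> else 0)" for e
    using q0[of e] \<zeta>_eq[of e 1] by auto
  have sum_q: "(\<Sum>k\<in>fixed v. poly q (\<zeta> ^ lg (v \<otimes> t k))) =
      of_nat (card {k \<in> fixed v. lg (v \<otimes> t k) mod n = 1 mod n}) * poly q \<zeta>" for v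
  proof -
    have "(\<Sum>k\<in>fixed v. poly q (\<zeta> ^ lg (v \<otimes> t k))) =
        (\<Sum>k\<in>fixed v. if lg (v \<otimes> t k) mod n = 1 mod n then poly q \<zeta> else 0)"
      by (rule sum.cong[OF refl q_val])
    also have "\<dots> = (\<Sum>k\<in>{k \<in> fixed v. lg (v \<otimes> t k) mod n = 1 mod n}. poly q \<zeta>)"
      by (rule sum.inter_filter[symmetric, OF finite_fixed])
    finally show ?thesis by simp
  qed
  have "poly q \<zeta> \<noteq> 0" using q0[of 1] by simp
  then have "card {k \<in> fixed x. lg (x \<otimes> t k) mod n = 1 mod n} = card {k \<in> fixed y. lg (y \<otimes> t k) mod n = 1 mod n}"
    using poly_eq[of q] unfolding sum_q by simp
  moreover have "{k \<in> fixed x. lg (x \<otimes> t k) mod n = 1 mod n} \<noteq> {}"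
    using fixed_self by (auto simp: n_def)
  then have "card {k \<in> fixed x. lg (x \<otimes> t k) mod n = 1 mod n} \<noteq> 0"
    using finite_fixed[of x] by simp
  ultimately have "{k \<in> fixed y. lg (y \<otimes> t k) mod n = 1 mod n} \<noteq> {}" by (metis card.empty)
  then obtain k where k: "k \<in> fixed y" "lg (y \<otimes> t k) mod n = 1 mod n" by auto
  have "x [^] lg (y \<otimes> t k) = x [^] (1::nat)"
    by (rule pow_mod_eq[OF xG k(2)[unfolded n_def]])
  then have "y \<otimes> t k = t k \<otimes> x" using fixedD[OF k(1) yG] xG by simp
  then have "y = t k \<otimes> x \<otimes> inv (t k)"
    using fixedD(1)[OF k(1) yG] xG yG by (metis inv_solve_right m_closed)
  then show ?thesis using fixedD(1)[OF k(1) yG] by blast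
qed

text \<open>The coefficients must be integers here because membership in \<open>gbc\<close> is
  claimed, so the support allows all generators of the cyclic group and not \<open>x\<close> alone.
  Nonnegative values at the powers of \<open>\<zeta>\<close> rule out cancellation in the sum over
  fixed cosets.\<close>

lemma (in modular_reduction) gbc_supported_on_generators:
  fixes G (structure)
  assumes "group G" and fin: "finite (carrier G)" and x_reg: "x \<in> p_regular p G"
  obtains f where "f \<in> gbc p M \<iota> G" "f x \<noteq> 0"
    "\<And>y. y \<in> p_regular p G \<Longrightarrow> f y \<noteq> 0 \<Longrightarrow>
       \<exists>g\<in>carrier G. \<exists>e. coprime e (group.ord G x) \<and> y = g \<otimes> x [^] (e::nat) \<otimes> inv g"
proof -
  interpret group G by fact
  have xG: "x \<in> carrier G" using x_reg by (auto simp: p_regular_def)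
  obtain m t idx lg where ct: "cyclic_transversal G x m t idx lg"
    using cyclic_transversal_exists[OF fin xG] by blast
  interpret cyclic_transversal G x m t idx lg by (rule ct)
  define n where "n = ord x"
  have n: "n > 0" using ord_ge_1[OF fin xG] by (simp add: n_def)
  obtain \<zeta> :: complex where \<zeta>: "\<And>k. \<zeta> ^ k = 1 \<longleftrightarrow> n dvd k"
    using ex_primitive_root_of_unity[OF n] by metis
  have \<zeta>n: "\<zeta> ^ ord x = 1" using \<zeta> by (simp add: n_def)
  \<comment> \<open>at \<open>\<zeta> ^ e\<close> this is a product of factors \<open>\<bar>1 - \<zeta> ^ (e * d)\<bar>\<^sup>2\<close>, hence nonnegative, and nonzero only if
    \<open>\<zeta> ^ e\<close> is again a primitive \<open>n\<close>-th root of unity\<close>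
  define q :: "int poly" where "q = (\<Prod>d\<in>{1..<n}. (1 - monom 1 d) * (1 - monom 1 ((n - 1) * d)))"
  define r where "r e = (\<Prod>d\<in>{1..<n}. (cmod (1 - \<zeta> ^ (e * d)))\<^sup>2)" for e
  have q: "poly (of_int_poly q) (\<zeta> ^ e) = of_real (r e)" for e
  proof -
    have factor: "(1 - \<zeta> ^ (e * d)) * (1 - \<zeta> ^ (e * ((n - 1) * d))) = of_real ((cmod (1 - \<zeta> ^ (e * d)))\<^sup>2)" for d
    proof -
      define w where "w = \<zeta> ^ (e * d)"
      have "w ^ n = 1" using \<zeta> by (simp add: w_def flip: power_mult)
      have "cmod w = 1" using power_eq_1_iff[OF \<open>w ^ n = 1\<close>] n by simp
      have "w * cnj w = 1" using \<open>cmod w = 1\<close> by (simp add: complex_norm_square[symmetric])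
      \<comment> \<open>The exponent \<open>n - 1\<close> inverts \<open>w\<close>, and on the unit
        circle the inverse is the complex conjugate; this is how an integer polynomial produces a
        squared modulus.\<close>
      moreover have "w * w ^ (n - 1) = 1" using \<open>w ^ n = 1\<close> n by (metis power_minus_mult mult.commute)
      ultimately have "w ^ (n - 1) = cnj w"
        by (metis mult_cancel_left mult_zero_left zero_neq_one)
      moreover have "\<zeta> ^ (e * ((n - 1) * d)) = w ^ (n - 1)"
        by (simp add: w_def mult_ac flip: power_mult)
      ultimately have "(1 - \<zeta> ^ (e * d)) * (1 - \<zeta> ^ (e * ((n - 1) * d))) = (1 - w) * cnj (1 - w)"
        by (simp add: w_def)
      then show ?thesis by (simp only: complex_norm_square w_def)
    qed
    have "poly (of_int_poly q) (\<zeta> ^ e) =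
        (\<Prod>d\<in>{1..<n}. (1 - \<zeta> ^ (e * d)) * (1 - \<zeta> ^ (e * ((n - 1) * d))))"
      by (simp add: q_def hom_distribs poly_prod poly_monom flip: power_mult)
    then show ?thesis unfolding factor by (simp add: r_def)
  qed
  have r_nonneg: "r e \<ge> 0" for e by (simp add: r_def prod_nonneg)
  have r_0: "r e \<noteq> 0 \<longleftrightarrow> coprime e n" for e
  proof -
    have "r e \<noteq> 0 \<longleftrightarrow> (\<forall>d\<in>{1..<n}. \<not> n dvd e * d)"
      by (auto simp: r_def \<zeta>)
    also have "\<dots> \<longleftrightarrow> coprime e n"
    proof
      assume *: "\<forall>d\<in>{1..<n}. \<not> n dvd e * d"
      define c where "c = gcd e n"
      have c: "c > 0" "c dvd e" "c dvd n" using n by (auto simp: c_def)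
      \<comment> \<open>The cofactor \<open>k\<close> satisfies \<open>n dvd e * k\<close>; if the
        gcd \<open>c\<close> exceeded 1, then \<open>k\<close> would lie in the range excluded by
        the assumption.\<close>
      obtain k where k: "n = c * k" using c(3) by (auto elim: dvdE)
      then have "n dvd e * k" using c(2) by (metis mult_dvd_mono dvd_refl)
      moreover have "k > 0" using k n by (cases k) auto
      ultimately have "\<not> k < n" using * by auto
      then have "c = 1" using k c(1) \<open>k > 0\<close> by (cases c) auto
      then show "coprime e n" by (simp add: c_def coprime_iff_gcd_eq_1)
    next
      assume "coprime e n"
      then have "n dvd e * d \<longleftrightarrow> n dvd d" for d
        by (simp add: coprime_commute coprime_dvd_mult_right_iff)
      then show "\<forall>d\<in>{1..<n}. \<not> n dvd e * d" by (auto dest: dvd_imp_le)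
    qed
    finally show ?thesis .
  qed
  define f where "f = (\<lambda>y\<in>p_regular p G. \<Sum>k\<in>fixed y. poly (of_int_poly q) (\<zeta> ^ lg (y \<otimes> t k)))"
  have f: "f y = of_real (\<Sum>k\<in>fixed y. r (lg (y \<otimes> t k)))" if "y \<in> p_regular p G" for y
    using that by (simp add: f_def q)
  have "f \<in> gbc p M \<iota> G" unfolding f_def by (rule induced_in_gbc[OF ct fin x_reg \<zeta>n])
  moreover have "f x \<noteq> 0"
  proof -
    obtain k where k: "k \<in> fixed x" "lg (x \<otimes> t k) mod n = 1 mod n" using fixed_self by (auto simp: n_def)
    have "coprime (lg (x \<otimes> t k)) n"
      using k(2) by (metis coprime_1_left coprime_mod_left_iff n neq0_conv)
    then have "0 < r (lg (x \<otimes> t k))"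
      using r_0 r_nonneg by (metis less_eq_real_def)
    also have "\<dots> \<le> (\<Sum>k\<in>fixed x. r (lg (x \<otimes> t k)))"
      using k(1) finite_fixed r_nonneg by (intro member_le_sum) auto
    finally show ?thesis unfolding f[OF x_reg] of_real_eq_0_iff by simp
  qed
  moreover have "\<exists>g\<in>carrier G. \<exists>e. coprime e (ord x) \<and> y = g \<otimes> x [^] (e::nat) \<otimes> inv g"
    if y: "y \<in> p_regular p G" and fy: "f y \<noteq> 0" for y
  proof -
    have yG: "y \<in> carrier G" using y by (simp add: p_regular_def)
    have "(\<Sum>k\<in>fixed y. r (lg (y \<otimes> t k))) \<noteq> 0" using fy unfolding f[OF y] of_real_eq_0_iff .
    then obtain k where k: "k \<in> fixed y" "r (lg (y \<otimes> t k)) \<noteq> 0" by (meson sum.neutral)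
    have "y = t k \<otimes> x [^] lg (y \<otimes> t k) \<otimes> inv (t k)"
      using fixedD[OF k(1) yG] xG yG by (metis inv_solve_right m_closed nat_pow_closed)
    then show ?thesis using k r_0 fixedD(1)[OF k(1) yG] by (auto simp: n_def)
  qed
  ultimately show thesis by (rule that)
qed

subsection \<open>Conjugacy classes and restriction\<close>

lemma (in group) p_regular_subgroup:
  assumes "subgroup H G"
  shows "p_regular p (G\<lparr>carrier := H\<rparr>) = p_regular p G \<inter> H"
proof -
  interpret H: group "G\<lparr>carrier := H\<rparr>" by (rule subgroup_imp_group[OF assms])
  have HG: "h \<in> carrier G" if "h \<in> H" for h using subgroup.mem_carrier[OF assms that] .
  have "H.ord h = ord h" if h: "h \<in> H" for h
  proof -
    have "H.ord h dvd k \<longleftrightarrow> ord h dvd k" for k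
      using h HG[OF h] H.pow_eq_id[of h k] pow_eq_id[of h k] by (simp add: nat_pow_consistent[symmetric])
    then show ?thesis by (metis dvd_antisym dvd_refl)
  qed
  then show ?thesis using HG by (auto simp: p_regular_def)
qed

definition conj_class :: "('a, 'b) monoid_scheme \<Rightarrow> 'a \<Rightarrow> 'a set" where
  "conj_class G x = {g \<otimes>\<^bsub>G\<^esub> x \<otimes>\<^bsub>G\<^esub> inv\<^bsub>G\<^esub> g | g. g \<in> carrier G}"

lemma (in group) p_regular_classes_eq: "p_regular_classes p G = conj_class G ` p_regular p G"
  by (force simp: p_regular_classes_def orbits_def orbit_def conj_class_def p_regular_def)

lemma (in group) conj_class_self: "x \<in> carrier G \<Longrightarrow> x \<in> conj_class G x"
  unfolding conj_class_def by (intro CollectI exI[of _ \<one>]) simp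

lemma (in group) conj_class_eqI:
  assumes x: "x \<in> carrier G" and y: "y \<in> conj_class G x"
  shows "conj_class G y = conj_class G x"
proof -
  obtain g where g: "g \<in> carrier G" "y = g \<otimes> x \<otimes> inv g" using y by (auto simp: conj_class_def)
  show ?thesis
  proof (intro equalityI subsetI)
    fix z assume "z \<in> conj_class G y"
    then obtain h where h: "h \<in> carrier G" "z = h \<otimes> y \<otimes> inv h" by (auto simp: conj_class_def)
    have "z = (h \<otimes> g) \<otimes> x \<otimes> inv (h \<otimes> g)" using g h x by (simp add: m_assoc inv_mult_group)
    then show "z \<in> conj_class G x" using g(1) h(1) by (auto simp: conj_class_def)
  next
    fix z assume "z \<in> conj_class G x"
    then obtain h where h: "h \<in> carrier G" "z = h \<otimes> x \<otimes> inv h" by (auto simp: conj_class_def)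
    have cancel: "inv g \<otimes> (g \<otimes> a) = a" if "a \<in> carrier G" for a
      using that g(1) by (metis inv_closed l_inv l_one m_assoc)
    have "z = (h \<otimes> inv g) \<otimes> y \<otimes> inv (h \<otimes> inv g)"
      using g h x by (simp add: m_assoc inv_mult_group cancel)
    then show "z \<in> conj_class G y" using g(1) h(1) by (auto simp: conj_class_def)
  qed
qed

theorem corollaryB:
  fixes G :: "('a, 'b) monoid_scheme"
    and H :: "'a set"
    and p :: nat
    and M :: "complex set"
    and \<iota> :: "complex set \<Rightarrow> 'f::field"
  assumes "group G" and "finite (carrier G)" and "subgroup H G" and "prime p"
    and "maximalideal M algebraic_integers" and "of_nat p \<in> M"
    and "\<iota> \<in> ring_iso (algebraic_integers Quot M) class_ring"
    and "(\<lambda>\<phi>. restrict \<phi> (p_regular p (G\<lparr>carrier := H\<rparr>))) \<in>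
           ring_iso (generalized_brauer_characters p M \<iota> G)
                    (generalized_brauer_characters p M \<iota> (G\<lparr>carrier := H\<rparr>))"
  shows "bij_betw (\<lambda>K. K \<inter> H) (p_regular_classes p G) (p_regular_classes p (G\<lparr>carrier := H\<rparr>))"
proof -
  interpret group G by fact
  interpret modular_reduction p M \<iota> by (rule modular_reduction.intro[OF assms(4-7)])
  let ?H = "G\<lparr>carrier := H\<rparr>"
  interpret H: group ?H by (rule subgroup_imp_group[OF assms(3)])
  have HG: "H \<subseteq> carrier G" using assms(3) by (rule subgroup.subset)
  have finH: "finite (carrier ?H)" using HG assms(2) finite_subset by auto
  have regH: "p_regular p ?H = p_regular p G \<inter> H" by (rule p_regular_subgroup[OF assms(3)])
  have regG: "x \<in> carrier G" if "x \<in> p_regular p G" for x using that by (simp add: p_regular_def)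
  \<comment> \<open>Surjectivity of restriction is used in \<open>fusion\<close>, injectivity in
    \<open>meets\<close>.\<close>
  have bij: "bij_betw (\<lambda>\<phi>. restrict \<phi> (p_regular p ?H)) (gbc p M \<iota> G) (gbc p M \<iota> ?H)"
    using assms(8) by (simp add: ring_iso_def)
  have conj_class_H: "conj_class ?H h = {g \<otimes>\<^bsub>G\<^esub> h \<otimes>\<^bsub>G\<^esub> inv\<^bsub>G\<^esub> g | g. g \<in> H}" for h
    using m_inv_consistent[OF assms(3)] by (force simp: conj_class_def)

  have fusion: "conj_class ?H h = conj_class G h \<inter> H" if h: "h \<in> p_regular p G" "h \<in> H" for h
  proof (intro equalityI subsetI)
    fix z assume "z \<in> conj_class ?H h"
    then show "z \<in> conj_class G h \<inter> H"
      using h(2) HG subgroup.m_closed[OF assms(3)] subgroup.m_inv_closed[OF assms(3)]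
      unfolding conj_class_H by (auto simp: conj_class_def)
  next
    fix z assume z: "z \<in> conj_class G h \<inter> H"
    then obtain g where g: "g \<in> carrier G" "z = g \<otimes>\<^bsub>G\<^esub> h \<otimes>\<^bsub>G\<^esub> inv\<^bsub>G\<^esub> g"
      by (auto simp: conj_class_def)
    have z_reg: "z \<in> p_regular p G" using p_regular_conj[OF h(1) g(1)] g(2) by simp
    have "f h = f z" if f_in: "f \<in> gbc p M \<iota> ?H" for f
    proof -
      \<comment> \<open>\<open>f\<close> extends to a generalized Brauer character \<open>F\<close>
        of \<open>G\<close>, which is constant on conjugacy classes of \<open>G\<close>.\<close>
      have "f \<in> (\<lambda>\<phi>. restrict \<phi> (p_regular p ?H)) ` gbc p M \<iota> G"
        using f_in bij by (simp add: bij_betw_def)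
      then obtain F where F: "F \<in> gbc p M \<iota> G" "f = restrict F (p_regular p ?H)"
        by (elim imageE)
      have "F h = F z" using gbc_conj[OF F(1) h(1) g(1)] g(2) by simp
      then show ?thesis using F(2) h z z_reg by (simp add: regH)
    qed
    then have "\<exists>g\<in>carrier ?H. z = g \<otimes>\<^bsub>?H\<^esub> h \<otimes>\<^bsub>?H\<^esub> inv\<^bsub>?H\<^esub> g"
      using h z z_reg by (intro gbc_separates[OF H.is_group finH]) (auto simp: regH)
    then show "z \<in> conj_class ?H h" by (auto simp: conj_class_def)
  qed

  have meets: "\<exists>h\<in>p_regular p G \<inter> H. conj_class G x = conj_class G h" if x: "x \<in> p_regular p G" for x
  proof (rule ccontr)
    assume none: "\<not> ?thesis"
    obtain f where f: "f \<in> gbc p M \<iota> G" "f x \<noteq> 0"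
      and supp: "\<And>y. y \<in> p_regular p G \<Longrightarrow> f y \<noteq> 0 \<Longrightarrow>
        \<exists>g\<in>carrier G. \<exists>e. coprime e (ord x) \<and> y = g \<otimes>\<^bsub>G\<^esub> x [^]\<^bsub>G\<^esub> (e::nat) \<otimes>\<^bsub>G\<^esub> inv\<^bsub>G\<^esub> g"
      using gbc_supported_on_generators[OF is_group assms(2) x] by metis
    have "f y = 0" if y: "y \<in> p_regular p G \<inter> H" for y
    proof (rule ccontr)
      assume "f y \<noteq> 0"
      then obtain g e where g: "g \<in> carrier G" and e: "coprime e (ord x)"
        and y_eq: "y = g \<otimes>\<^bsub>G\<^esub> x [^]\<^bsub>G\<^esub> (e::nat) \<otimes>\<^bsub>G\<^esub> inv\<^bsub>G\<^esub> g"
        using supp y by blast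
      have xG: "x \<in> carrier G" by (rule regG[OF x])
      \<comment> \<open>An inverse of \<open>e\<close> modulo \<open>ord x\<close>: raising
        \<open>y\<close>, a conjugate of \<open>x [^] e\<close>, to the power \<open>d\<close> gives
        a conjugate of \<open>x\<close> itself, and this power remains in \<open>H\<close>.\<close>
      obtain d where d: "[e * d = 1] (mod ord x)"
        using cong_solve_coprime_nat[OF e] by auto
      have pow: "y [^]\<^bsub>G\<^esub> d = g \<otimes>\<^bsub>G\<^esub> x \<otimes>\<^bsub>G\<^esub> inv\<^bsub>G\<^esub> g"
        using d pow_mod_eq[OF xG, of "e * d" 1] xG g by (simp add: y_eq conj_pow nat_pow_pow cong_def)
      have h: "y [^]\<^bsub>G\<^esub> d \<in> p_regular p G \<inter> H"
        using p_regular_conj[OF x g] y H.nat_pow_closed[of y d] nat_pow_consistent[of y d H]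
        by (simp add: pow)
      have "y [^]\<^bsub>G\<^esub> d \<in> conj_class G x" using g by (auto simp: conj_class_def pow)
      then have "conj_class G x = conj_class G (y [^]\<^bsub>G\<^esub> d)"
        using conj_class_eqI[OF xG] by simp
      then show False using none h by blast
    qed
    \<comment> \<open>Since \<open>f\<close> vanishes on the \<open>p\<close>-regular elements of
      \<open>H\<close>, it has the same restriction as the zero character; injectivity then
      contradicts \<open>f x \<noteq> 0\<close>.\<close>
    then have "restrict f (p_regular p ?H) = restrict (\<lambda>g\<in>p_regular p G. 0) (p_regular p ?H)"
      by (auto simp: regH intro!: restrict_ext)
    then have "f = (\<lambda>g\<in>p_regular p G. 0)"
      by (rule inj_onD[OF bij_betw_imp_inj_on[OF bij] _ f(1) gbc_zero])
    then show False using f(2) x by simp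
  qed

  show ?thesis
    unfolding p_regular_classes_eq H.p_regular_classes_eq regH
  \<comment> \<open>By \<open>meets\<close> each class has a representative in \<open>H\<close>, and
    classes sharing an element coincide, which gives injectivity; \<open>fusion\<close> identifies
    the intersections with the classes of \<open>H\<close>.\<close>
  proof (rule bij_betwI')
    fix K L assume KL: "K \<in> conj_class G ` p_regular p G" "L \<in> conj_class G ` p_regular p G"
    obtain h where h: "h \<in> p_regular p G \<inter> H" "K = conj_class G h" using KL(1) meets by blast
    show "(K \<inter> H = L \<inter> H) = (K = L)"
    proof
      assume "K \<inter> H = L \<inter> H"
      then have "h \<in> L" using h conj_class_self[OF regG] by blast
      then show "K = L" using KL(2) h conj_class_eqI[OF regG] by blast
    qed simp
  next
    fix K assume "K \<in> conj_class G ` p_regular p G"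
    then obtain h where "h \<in> p_regular p G \<inter> H" "K = conj_class G h" using meets by blast
    then show "K \<inter> H \<in> conj_class ?H ` (p_regular p G \<inter> H)" using fusion by blast
  next
    fix L assume "L \<in> conj_class ?H ` (p_regular p G \<inter> H)"
    then show "\<exists>K\<in>conj_class G ` p_regular p G. L = K \<inter> H" using fusion by blast
  qed
qed

end
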